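(* Let $n\ge1$. The complexification of the real vector space $$\mathfrak{R}^a=S^2\big(\rho(sp(n)\oplus u(1))\big)\cap b^{-1}\big(\mathbb{R}\,\sigma_{T_0+\overline{T}_0}\big)$$ is isomorphic to $\mathbb{C}\oplus S^4E$ as a $\rho(Sp(n)U(1))$-representation, where $\mathbb{C}$ is the trivial representation and $E$ is the standard $2n$-dimensional complex representation of $Sp(n)$ (with $U(1)$ acting trivially on $S^4E$).
   Context: $Sp(n)U(1)=\{ab: a\in Sp(n),b\in U(1)\}\subset U(2n)$ ($U(1)$ acting by scalars), and $\rho:Sp(n)U(1)\to U(2n)\times U(1)\subset U(2n+1)\subset SO(4n+2)$ is $\rho(ab)=\begin{pmatrix}ab&0\\0&b^2\end{pmatrix}$. $T\cong\mathbb{R}^{4n+2}=\mathbb{C}^{2n+1}$ is the standard representation of $U(2n+1)$ with inner product $g$; $e_1,\dots,e_{2n+1}$ is the standard unitary basis of $T^{1,0}$ (so $g(e_i,\bar e_j)=\delta_{ij}$ for the complex bilinear extension of $g$), $e^1,\dots,e^{2n+1}$ the dual basis. Put $\omega_0=\sum_{k=1}^ne^{2k-1}\wedge e^{2k}$ ($Sp(n)$ is the stabilizer of $\omega_0$ in $U(2n)$) and $T_0=\omega_0\wedge\bar e^{2n+1}$. For a real 3-form $\Theta$ on $T$, let $\Theta(X,Y)\in T$ be defined by $g(\Theta(X,Y),Z)=\Theta(X,Y,Z)$ and let $$\sigma_\Theta(X,Y,Z,W)=\mathfrak{S}_{X,Y,Z}\,g(\Theta(X,Y),\Theta(Z,W)),$$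 where $\mathfrak{S}_{X,Y,Z}$ is the cyclic sum. $b:(T^* )^{\otimes4}\to(T^* )^{\otimes4}$ is $(bR)(X,Y,Z,W)=\mathfrak{S}_{X,Y,Z}R(X,Y,Z,W)$. $\rho(sp(n)\oplus u(1))$ is the Lie algebra of $\rho(Sp(n)U(1))$, regarded as a subspace of $so(T)\cong\Lambda^2T^*$ via $g$, so that its symmetric square is a subspace of $S^2(\Lambda^2T^* )\subset(T^* )^{\otimes4}$. *)

theory Defs
  imports "HOL-Analysis.Analysis" "HOL-Library.Function_Algebras"
begin

section \<open>Representations of matrix groups\<close>

definition representation ::
  "(complex^'m^'m) set \<Rightarrow> (complex \<Rightarrow> 'v \<Rightarrow> 'v::ab_group_add) \<Rightarrow> 'v set
     \<Rightarrow> (complex^'m^'m \<Rightarrow> 'v \<Rightarrow> 'v) \<Rightarrow> bool" where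
  "representation G sc V act \<longleftrightarrow>
     vector_space sc \<and> module.subspace sc V \<and>
     (\<forall>h\<in>G. \<forall>x\<in>V. act h x \<in> V) \<and>
     (\<forall>h\<in>G. \<forall>x\<in>V. \<forall>y\<in>V. act h (x + y) = act h x + act h y) \<and>
     (\<forall>h\<in>G. \<forall>c. \<forall>x\<in>V. act h (sc c x) = sc c (act h x)) \<and>
     (\<forall>x\<in>V. act (mat 1) x = x) \<and>
     (\<forall>h\<in>G. \<forall>k\<in>G. \<forall>x\<in>V. act (h ** k) x = act h (act k x))"

definition rep_isomorphic ::
  "(complex^'m^'m) set
     \<Rightarrow> (complex \<Rightarrow> 'v \<Rightarrow> 'v::ab_group_add) \<Rightarrow> 'v set \<Rightarrow> (complex^'m^'m \<Rightarrow> 'v \<Rightarrow> 'v)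
     \<Rightarrow> (complex \<Rightarrow> 'w \<Rightarrow> 'w::ab_group_add) \<Rightarrow> 'w set \<Rightarrow> (complex^'m^'m \<Rightarrow> 'w \<Rightarrow> 'w)
     \<Rightarrow> bool" where
  "rep_isomorphic G sc1 V act1 sc2 W act2 \<longleftrightarrow>
     representation G sc1 V act1 \<and> representation G sc2 W act2 \<and>
     (\<exists>\<Phi>. bij_betw \<Phi> V W \<and>
          (\<forall>x\<in>V. \<forall>y\<in>V. \<Phi> (x + y) = \<Phi> x + \<Phi> y) \<and>
          (\<forall>c. \<forall>x\<in>V. \<Phi> (sc1 c x) = sc2 c (\<Phi> x)) \<and>
          (\<forall>h\<in>G. \<forall>x\<in>V. \<Phi> (act1 h x) = act2 h (\<Phi> x)))"

text \<open>
  The complexification of a real vector space \<open>V\<close> is carried by \<open>V \<times> V\<close>,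
  the pair \<open>(x, y)\<close> standing for \<open>x + \<i> y\<close>; real linear maps act componentwise.
\<close>

definition cx_scale ::
  "(real \<Rightarrow> 'v \<Rightarrow> 'v::ab_group_add) \<Rightarrow> complex \<Rightarrow> 'v \<times> 'v \<Rightarrow> 'v \<times> 'v" where
  "cx_scale sc c = (\<lambda>(x, y). (sc (Re c) x - sc (Im c) y, sc (Im c) x + sc (Re c) y))"

definition complexification :: "'v set \<Rightarrow> ('v \<times> 'v) set" where
  "complexification V = V \<times> V"

definition cx_act :: "('g \<Rightarrow> 'v \<Rightarrow> 'v) \<Rightarrow> 'g \<Rightarrow> 'v \<times> 'v \<Rightarrow> 'v \<times> 'v" where
  "cx_act act h = map_prod (act h) (act h)"

definition fscale :: "'k::times \<Rightarrow> ('a \<Rightarrow> 'a \<Rightarrow> 'a \<Rightarrow> 'a \<Rightarrow> 'k) \<Rightarrow> 'a \<Rightarrow> 'a \<Rightarrow> 'a \<Rightarrow> 'a \<Rightarrow> 'k" where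
  "fscale c R = (\<lambda>x y z w. c * R x y z w)"

lemma vector_space_fscale:
  "vector_space (fscale :: 'k::field \<Rightarrow> ('a \<Rightarrow> 'a \<Rightarrow> 'a \<Rightarrow> 'a \<Rightarrow> 'k) \<Rightarrow> _)"
  by unfold_locales (auto simp: fscale_def fun_eq_iff algebra_simps)


section \<open>The space \<open>T\<close> and the form \<open>T\<^sub>0\<close>\<close>

text \<open>
  Here \<open>n = CARD('n)\<close>. The indices \<open>2k - 1\<close> and \<open>2k\<close> are \<open>(k, False)\<close> and \<open>(k, True)\<close>
  for \<open>E = \<complex>\<^sup>2\<^sup>n\<close>, the same wrapped in \<open>Some\<close> for \<open>T = \<complex>\<^sup>2\<^sup>n\<^sup>+\<^sup>1\<close>, and \<open>None\<close> is
  the index \<open>2n + 1\<close>. The metric \<open>g\<close> is the real inner product of \<open>T\<close>.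
\<close>

type_synonym 'n idxE = "'n \<times> bool"
type_synonym 'n idxT = "('n \<times> bool) option"
type_synonym 'n T = "complex ^ 'n idxT"
type_synonym 'n matE = "complex ^ 'n idxE ^ 'n idxE"
type_synonym 'n matT = "complex ^ 'n idxT ^ 'n idxT"
type_synonym 'n tensor4 = "'n T \<Rightarrow> 'n T \<Rightarrow> 'n T \<Rightarrow> 'n T \<Rightarrow> real"

text \<open>
  The standard coordinate vectors of \<open>T\<close> have \<open>g\<close>-length 1, so the unitary basis of
  \<open>T\<^sup>1\<^sup>,\<^sup>0\<close> is \<open>e\<^sub>i = (u\<^sub>i - \<i> J u\<^sub>i) / \<surd>2\<close> where \<open>u\<^sub>i = axis i 1\<close>, \<open>J u\<^sub>i = axis i \<i>\<close>.
  The dual basis, restricted to real vectors, is the \<open>i\<close>-th coordinate divided by \<open>\<surd>2\<close>.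
\<close>

definition e_vec :: "'n::finite idxT \<Rightarrow> 'n T \<times> 'n T" where
  "e_vec i = cx_scale (*\<^sub>R) (1 / of_real (sqrt 2)) (axis i 1, - axis i \<i>)"

definition e_form :: "'n::finite idxT \<Rightarrow> 'n T \<Rightarrow> complex" where
  "e_form i X = X $ i / of_real (sqrt 2)"

definition cx_conj :: "'n::finite T \<times> 'n T \<Rightarrow> 'n T \<times> 'n T" where
  "cx_conj = (\<lambda>(x, y). (x, - y))"

definition g_ext :: "'n::finite T \<times> 'n T \<Rightarrow> 'n T \<times> 'n T \<Rightarrow> complex" where
  "g_ext = (\<lambda>(x, y) (x', y'). Complex (x \<bullet> x' - y \<bullet> y') (x \<bullet> y' + y \<bullet> x'))"

definition form_ext :: "('n::finite T \<Rightarrow> complex) \<Rightarrow> 'n T \<times> 'n T \<Rightarrow> complex" where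
  "form_ext \<alpha> = (\<lambda>(x, y). \<alpha> x + \<i> * \<alpha> y)"

lemma axis_inner_axis_complex:
  "(axis i a :: complex^'m::finite) \<bullet> axis j b = (if i = j then a \<bullet> b else 0)"
  by (auto simp: inner_axis_axis)

lemma e_vec_eq:
  "e_vec i = (axis i (of_real (1 / sqrt 2)), axis i (- \<i> * of_real (1 / sqrt 2)))"
proof -
  have "1 / complex_of_real (sqrt 2) = of_real (1 / sqrt 2)" by simp
  then have "Re (1 / complex_of_real (sqrt 2)) = 1 / sqrt 2" "Im (1 / complex_of_real (sqrt 2)) = 0"
    by (metis Re_complex_of_real, metis Im_complex_of_real)
  then show ?thesis
    by (auto simp: e_vec_def cx_scale_def vec_eq_iff axis_def complex_eq_iff)
qed

lemma e_vec_type_1_0: "map_prod ((*s) \<i>) ((*s) \<i>) (e_vec i) = cx_scale (*\<^sub>R) \<i> (e_vec i)"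
  by (auto simp: e_vec_eq cx_scale_def vec_eq_iff axis_def)

lemma e_vec_unitary: "g_ext (e_vec i) (cx_conj (e_vec j)) = (if i = j then 1 else 0)"
  by (auto simp: e_vec_eq g_ext_def cx_conj_def axis_inner_axis_complex inner_complex_def
      complex_eq_iff)

lemma e_form_dual:
  "form_ext (e_form i) (e_vec j) = (if i = j then 1 else 0)"
  "form_ext (e_form i) (cx_conj (e_vec j)) = 0"
proof -
  have "1 / (complex_of_real (sqrt 2) * complex_of_real (sqrt 2)) = 1 / 2"
    by (simp flip: of_real_mult)
  then show "form_ext (e_form i) (e_vec j) = (if i = j then 1 else 0)"
    "form_ext (e_form i) (cx_conj (e_vec j)) = 0"
    by (auto simp: e_vec_eq form_ext_def cx_conj_def e_form_def axis_def)
qed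

definition wedge_1_1 :: "('v \<Rightarrow> complex) \<Rightarrow> ('v \<Rightarrow> complex) \<Rightarrow> 'v \<Rightarrow> 'v \<Rightarrow> complex" where
  "wedge_1_1 \<alpha> \<beta> X Y = \<alpha> X * \<beta> Y - \<alpha> Y * \<beta> X"

definition wedge_2_1 ::
  "('v \<Rightarrow> 'v \<Rightarrow> complex) \<Rightarrow> ('v \<Rightarrow> complex) \<Rightarrow> 'v \<Rightarrow> 'v \<Rightarrow> 'v \<Rightarrow> complex" where
  "wedge_2_1 \<omega> \<beta> X Y Z = \<omega> X Y * \<beta> Z + \<omega> Y Z * \<beta> X + \<omega> Z X * \<beta> Y"

definition \<omega>\<^sub>0 :: "'n::finite T \<Rightarrow> 'n T \<Rightarrow> complex" where
  "\<omega>\<^sub>0 X Y = (\<Sum>k\<in>UNIV. wedge_1_1 (e_form (Some (k, False))) (e_form (Some (k, True))) X Y)"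

definition T\<^sub>0 :: "'n::finite T \<Rightarrow> 'n T \<Rightarrow> 'n T \<Rightarrow> complex" where
  "T\<^sub>0 = wedge_2_1 \<omega>\<^sub>0 (\<lambda>X. cnj (e_form None X))"

text \<open>\<open>T\<^sub>0\<close> plus its conjugate takes real values, so taking \<open>Re\<close> only changes the type.\<close>

definition Theta\<^sub>0 :: "'n::finite T \<Rightarrow> 'n T \<Rightarrow> 'n T \<Rightarrow> real" where
  "Theta\<^sub>0 X Y Z = Re (T\<^sub>0 X Y Z + cnj (T\<^sub>0 X Y Z))"


section \<open>The group \<open>\<rho>(Sp(n)U(1))\<close> and its Lie algebra\<close>

definition cadjoint :: "complex^'m^'m \<Rightarrow> complex^'m^'m" where
  "cadjoint A = (\<chi> i j. cnj (A $ j $ i))"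

definition unitary_group :: "(complex^'m^'m) set" where
  "unitary_group = {A. cadjoint A ** A = mat 1 \<and> A ** cadjoint A = mat 1}"

definition U1 :: "complex set" where
  "U1 = {b. cmod b = 1}"

definition block_diag :: "'n::finite matE \<Rightarrow> complex \<Rightarrow> 'n matT" where
  "block_diag A c = (\<chi> i j. case (i, j) of
      (Some p, Some q) \<Rightarrow> A $ p $ q
    | (None, None) \<Rightarrow> c
    | _ \<Rightarrow> 0)"

definition Sp :: "'n::finite matE set" where
  "Sp = {a \<in> unitary_group.
     \<forall>X Y. \<omega>\<^sub>0 (block_diag a 1 *v X) (block_diag a 1 *v Y) = \<omega>\<^sub>0 X Y}"

text \<open>\<open>\<rho> a b\<close> is the image of the product \<open>ab\<close>, that is \<open>\<rho>(ab)\<close>.\<close>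

definition \<rho> :: "'n::finite matE \<Rightarrow> complex \<Rightarrow> 'n matT" where
  "\<rho> a b = block_diag (a ** mat b) (b\<^sup>2)"

definition SpU1 :: "'n::finite matT set" where
  "SpU1 = {\<rho> a b | a b. a \<in> Sp \<and> b \<in> U1}"

text \<open>The Lie algebra of a matrix group, as its tangent space at the identity.\<close>

definition lie_algebra :: "(complex^'m^'m) set \<Rightarrow> (complex^'m^'m) set" where
  "lie_algebra G = {A. \<exists>\<gamma> :: real \<Rightarrow> complex^'m^'m.
     (\<forall>t. \<gamma> t \<in> G) \<and> (\<forall>t. \<gamma> differentiable at t) \<and> \<gamma> 0 = mat 1 \<and>
     (\<gamma> has_vector_derivative A) (at 0)}"

definition two_form :: "'n::finite matT \<Rightarrow> 'n T \<Rightarrow> 'n T \<Rightarrow> real" where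
  "two_form A X Y = (A *v X) \<bullet> Y"


section \<open>The space \<open>R\<^sup>a\<close> of curvature tensors\<close>

definition sym_prod :: "('v \<Rightarrow> 'v \<Rightarrow> real) \<Rightarrow> ('v \<Rightarrow> 'v \<Rightarrow> real) \<Rightarrow> 'v \<Rightarrow> 'v \<Rightarrow> 'v \<Rightarrow> 'v \<Rightarrow> real" where
  "sym_prod \<alpha> \<beta> X Y Z W = \<alpha> X Y * \<beta> Z W + \<beta> X Y * \<alpha> Z W"

definition S2 :: "('v \<Rightarrow> 'v \<Rightarrow> real) set \<Rightarrow> ('v \<Rightarrow> 'v \<Rightarrow> 'v \<Rightarrow> 'v \<Rightarrow> real) set" where
  "S2 H = module.span fscale {sym_prod \<alpha> \<beta> | \<alpha> \<beta>. \<alpha> \<in> H \<and> \<beta> \<in> H}"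

definition bianchi :: "('v \<Rightarrow> 'v \<Rightarrow> 'v \<Rightarrow> 'v \<Rightarrow> real) \<Rightarrow> 'v \<Rightarrow> 'v \<Rightarrow> 'v \<Rightarrow> 'v \<Rightarrow> real" where
  "bianchi R X Y Z W = R X Y Z W + R Y Z X W + R Z X Y W"

definition vec_of_form :: "('v::real_inner \<Rightarrow> 'v \<Rightarrow> 'v \<Rightarrow> real) \<Rightarrow> 'v \<Rightarrow> 'v \<Rightarrow> 'v" where
  "vec_of_form \<Theta> X Y = (THE V. \<forall>Z. V \<bullet> Z = \<Theta> X Y Z)"

lemma inner_vec_of_form:
  fixes \<Theta> :: "'v::euclidean_space \<Rightarrow> 'v \<Rightarrow> 'v \<Rightarrow> real"
  assumes "linear (\<Theta> X Y)"
  shows "vec_of_form \<Theta> X Y \<bullet> Z = \<Theta> X Y Z"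
proof -
  have ex: "\<forall>Z. adjoint (\<Theta> X Y) 1 \<bullet> Z = \<Theta> X Y Z"
    using adjoint_clauses(2)[OF assms, of 1] by simp
  have "\<forall>Z. vec_of_form \<Theta> X Y \<bullet> Z = \<Theta> X Y Z"
    unfolding vec_of_form_def
    by (rule theI[where a = "adjoint (\<Theta> X Y) 1"], rule ex)
       (metis ex vector_eq_rdot)
  then show ?thesis by blast
qed

definition sigma ::
  "('v::real_inner \<Rightarrow> 'v \<Rightarrow> 'v \<Rightarrow> real) \<Rightarrow> 'v \<Rightarrow> 'v \<Rightarrow> 'v \<Rightarrow> 'v \<Rightarrow> real" where
  "sigma \<Theta> X Y Z W =
     vec_of_form \<Theta> X Y \<bullet> vec_of_form \<Theta> Z W +
     vec_of_form \<Theta> Y Z \<bullet> vec_of_form \<Theta> X W +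
     vec_of_form \<Theta> Z X \<bullet> vec_of_form \<Theta> Y W"

definition Ra :: "'n::finite tensor4 set" where
  "Ra = S2 (two_form ` lie_algebra SpU1) \<inter> bianchi -` range (\<lambda>c. fscale c (sigma Theta\<^sub>0))"

definition tensor_act :: "'n::finite matT \<Rightarrow> 'n tensor4 \<Rightarrow> 'n tensor4" where
  "tensor_act h R X Y Z W =
     R (matrix_inv h *v X) (matrix_inv h *v Y) (matrix_inv h *v Z) (matrix_inv h *v W)"


section \<open>The representation \<open>\<complex> \<oplus> S\<^sup>4E\<close>\<close>

text \<open>
  Elements of the fourth tensor power of \<open>E = \<complex>\<^sup>2\<^sup>n\<close> are given by their components,
  and \<open>S\<^sup>4E\<close> consists of the symmetric ones.
\<close>

type_synonym 'i ctensor4 = "'i \<Rightarrow> 'i \<Rightarrow> 'i \<Rightarrow> 'i \<Rightarrow> complex"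

definition pure4 ::
  "complex^'i \<Rightarrow> complex^'i \<Rightarrow> complex^'i \<Rightarrow> complex^'i \<Rightarrow> 'i ctensor4" where
  "pure4 u v w x = (\<lambda>i j k l. u $ i * v $ j * w $ k * x $ l)"

definition S4 :: "'i ctensor4 set" where
  "S4 = {t. \<forall>i j k l. t i j k l = t j i k l \<and> t i j k l = t i k j l \<and> t i j k l = t i j l k}"

definition act4 :: "complex^'i^'i \<Rightarrow> 'i::finite ctensor4 \<Rightarrow> 'i ctensor4" where
  "act4 a t = (\<lambda>i j k l. \<Sum>p\<in>UNIV. \<Sum>q\<in>UNIV. \<Sum>r\<in>UNIV. \<Sum>s\<in>UNIV.
      a $ i $ p * a $ j $ q * a $ k $ r * a $ l $ s * t p q r s)"

lemma act4_pure4: "act4 a (pure4 u v w x) = pure4 (a *v u) (a *v v) (a *v w) (a *v x)"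
proof -
  have prod4: "(\<Sum>p\<in>UNIV. \<Sum>q\<in>UNIV. \<Sum>r\<in>UNIV. \<Sum>s\<in>UNIV. A p * (B q * (C r * D s))) =
      sum A UNIV * (sum B UNIV * (sum C UNIV * sum D UNIV))"
    for A B C D :: "'i \<Rightarrow> complex"
    by (simp only: sum_distrib_left[symmetric] sum_distrib_right[symmetric])
  show ?thesis
    unfolding act4_def pure4_def matrix_vector_mult_def
    by (simp add: prod4[symmetric] mult.assoc) (simp add: mult_ac)
qed

text \<open>
  The element \<open>\<rho>(ab)\<close> acts on \<open>S\<^sup>4E\<close> as \<open>a\<close>. It determines \<open>a\<close> only up to sign, which does
  not matter on a fourth tensor power.
\<close>

definition S4E_act :: "'n::finite matT \<Rightarrow> 'n idxE ctensor4 \<Rightarrow> 'n idxE ctensor4" where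
  "S4E_act h = act4 (SOME a. a \<in> Sp \<and> (\<exists>b\<in>U1. h = \<rho> a b))"

lemma matrix_mult_mat_nth: "(a ** mat b) $ i $ j = a $ i $ j * (b::complex)"
  by (simp add: matrix_matrix_mult_def mat_def if_distrib cong: if_cong)

lemma S4E_act_rho:
  assumes a: "a \<in> Sp" and b: "b \<in> U1"
  shows "S4E_act (\<rho> a b) = act4 a"
proof -
  define a' where "a' = (SOME a'. a' \<in> Sp \<and> (\<exists>b'\<in>U1. \<rho> a b = \<rho> a' b'))"
  have "a' \<in> Sp \<and> (\<exists>b'\<in>U1. \<rho> a b = \<rho> a' b')"
    unfolding a'_def by (rule someI[where x = a]) (use a b in blast)
  then obtain b' where b': "b' \<in> U1" and eq: "\<rho> a b = \<rho> a' b'" by blast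
  have "\<rho> a b $ None $ None = \<rho> a' b' $ None $ None" using eq by simp
  then have "b\<^sup>2 = b'\<^sup>2" by (simp add: \<rho>_def block_diag_def)
  then have sgn: "b = b' \<or> b = - b'" by (simp add: power2_eq_iff)
  have nz: "b' \<noteq> 0" using b' by (auto simp: U1_def)
  have ent: "a $ i $ j * b = a' $ i $ j * b'" for i j
  proof -
    have "\<rho> a b $ Some i $ Some j = \<rho> a' b' $ Some i $ Some j" using eq by simp
    then show ?thesis by (simp add: \<rho>_def block_diag_def matrix_mult_mat_nth)
  qed
  from sgn have "(\<forall>i j. a' $ i $ j = a $ i $ j) \<or> (\<forall>i j. a' $ i $ j = - a $ i $ j)"
  proof
    assume "b = b'"
    then show ?thesis using ent nz by simp
  next
    assume "b = - b'"
    then have "a' $ i $ j = - a $ i $ j" for i j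
      using ent[of i j] nz by (metis mult_minus_left mult_minus_right mult_right_cancel)
    then show ?thesis by blast
  qed
  then have "act4 a' = act4 a" by (intro ext, elim disjE) (simp_all add: act4_def del: split_paired_All)
  then show ?thesis by (simp add: S4E_act_def a'_def)
qed

definition CS4E :: "(complex \<times> 'n::finite idxE ctensor4) set" where
  "CS4E = UNIV \<times> S4"

definition CS4E_scale ::
  "complex \<Rightarrow> complex \<times> 'n::finite idxE ctensor4 \<Rightarrow> complex \<times> 'n idxE ctensor4" where
  "CS4E_scale c = map_prod ((*) c) (fscale c)"

definition CS4E_act ::
  "'n::finite matT \<Rightarrow> complex \<times> 'n idxE ctensor4 \<Rightarrow> complex \<times> 'n idxE ctensor4" where
  "CS4E_act h = map_prod id (S4E_act h)"

end

theory Submission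
  imports Defs
begin

text \<open>
  Write \<open>h\<close> and \<open>\<omega>\<close> for the Hermitian and the symplectic form on \<open>E\<close>. The forms
  \<open>\<omega>(v, X) h(w, Y) - \<omega>(v, Y) h(w, X)\<close>, symmetrised in \<open>v, w \<in> E\<close>, span the complexification of
  \<open>sp(n)\<close>, which is \<open>S\<^sup>2E\<close>. Substituting them for two pairs of slots of \<open>t \<in> S\<^sup>4E\<close> gives an element of
  \<open>S\<^sup>2(sp(n))\<close> whose Bianchi sum cancels because \<open>t\<close> is totally symmetric. The trivial summand is
  spanned by a combination of the square of the \<open>u(1)\<close> generator and the Casimir element of \<open>sp(n)\<close>
  with Bianchi sum \<open>2\<sigma>\<close>.

  Conversely, let \<open>S\<close> in the symmetric square have vanishing Bianchi sum. With two arguments in the line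
  \<open>\<complex>e\<^sub>2\<^sub>n\<^sub>+\<^sub>1\<close> and two in \<open>E\<close>, all but one of the three summands vanish since the forms are block diagonal;
  as \<open>u(1)\<close> acts faithfully on that line, \<open>S\<close> lies in \<open>S\<^sup>2(sp(n))\<close>. Its component of type \<open>(1,0)\<close> in
  the first and third and \<open>(0,1)\<close> in the other arguments is then symmetric under the exchange of the
  first and third arguments by the Bianchi identity, hence totally symmetric, and it determines \<open>S\<close>.
\<close>

section \<open>Hermitian and symplectic coordinates\<close>

definition herm :: "'n::finite T \<Rightarrow> 'n T \<Rightarrow> complex" where
  "herm X Y = (\<Sum>p\<in>UNIV. X $ Some p * cnj (Y $ Some p))"

definition sympl :: "'n::finite T \<Rightarrow> 'n T \<Rightarrow> complex" where
  "sympl X Y = (\<Sum>k\<in>UNIV. X $ Some (k, False) * Y $ Some (k, True) - X $ Some (k, True) * Y $ Some (k, False))"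

definition bvec :: "'n::finite idxE \<Rightarrow> 'n T" where
  "bvec i = axis (Some i) 1"

text \<open>The basis dual to \<open>bvec\<close> under the symplectic form:
  \<open>sympl (bvec i) (dvec j)\<close> is 1 for \<open>i = j\<close> and 0 otherwise. Thus
  \<open>scoord\<close> gives coordinates with respect to \<open>dvec\<close>.\<close>

definition dvec :: "'n::finite idxE \<Rightarrow> 'n T" where
  "dvec i = (if snd i then - bvec (fst i, False) else bvec (fst i, True))"

definition scoord :: "'n::finite T \<Rightarrow> 'n idxE \<Rightarrow> complex" where
  "scoord X i = sympl (bvec i) X"

lemma sum_idxE: "(\<Sum>p\<in>UNIV. f p) = (\<Sum>k\<in>UNIV. f (k, False) + f (k, True))"
  for f :: "'n::finite idxE \<Rightarrow> 'b::comm_monoid_add"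
proof -
  have "(\<Sum>p\<in>UNIV. f p) = (\<Sum>k\<in>UNIV. \<Sum>c\<in>UNIV. f (k, c))"
    by (simp add: sum.cartesian_product)
  then show ?thesis by (simp add: UNIV_bool add.commute)
qed

lemma sum_idxT: "(\<Sum>p\<in>UNIV. f p) = f None + (\<Sum>p\<in>UNIV. f (Some p))"
  for f :: "'a::finite option \<Rightarrow> 'b::comm_monoid_add"
  by (simp add: UNIV_option_conv sum.reindex)

lemma bvec_nth [simp]: "bvec i $ None = 0" "bvec i $ Some p = (if i = p then 1 else 0)"
  by (auto simp: bvec_def axis_def)

lemma dvec_nth [simp]: "dvec i $ None = 0"
  by (simp add: dvec_def)

lemma scoord_eq:
  "scoord X (k, False) = X $ Some (k, True)" "scoord X (k, True) = - X $ Some (k, False)"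
  by (simp_all add: scoord_def sympl_def if_distrib if_distribR cong: if_cong)

lemma scoord_dvec: "scoord (dvec i) j = (if i = j then 1 else 0)"
  by (cases i; cases j; cases "snd i"; cases "snd j") (auto simp: scoord_eq dvec_def)

lemma \<omega>\<^sub>0_sympl: "\<omega>\<^sub>0 X Y = sympl X Y / 2"
proof -
  have "complex_of_real (sqrt 2) * complex_of_real (sqrt 2) = 2"
    by (simp flip: of_real_mult)
  then show ?thesis
    by (simp add: \<omega>\<^sub>0_def sympl_def wedge_1_1_def e_form_def sum_divide_distrib diff_divide_distrib mult.commute)
qed

lemma sympl_scoord: "sympl X Y = (\<Sum>i\<in>UNIV. X $ Some i * scoord Y i)"
  by (simp add: sum_idxE scoord_eq sympl_def)

lemma sympl_commute: "sympl Y X = - sympl X Y"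
  by (simp add: sympl_def flip: sum_negf) (simp add: algebra_simps)

lemma herm_commute: "herm Y X = cnj (herm X Y)"
  by (simp add: herm_def mult.commute)

lemma herm_bvec: "herm (bvec i) X = cnj (X $ Some i)" "herm X (bvec i) = X $ Some i"
  by (simp_all add: herm_def if_distrib if_distribR cong: if_cong)

lemma sympl_dvec: "sympl X (dvec i) = X $ Some i"
  by (simp add: sympl_scoord scoord_dvec if_distrib if_distribR cong: if_cong)

lemma herm_lin [simp]:
  "herm (X + Y) Z = herm X Z + herm Y Z" "herm Z (X + Y) = herm Z X + herm Z Y"
  "herm (c *s X) Z = c * herm X Z" "herm Z (c *s X) = cnj c * herm Z X"
  "herm (- X) Z = - herm X Z" "herm Z (- X) = - herm Z X"
  "herm (r *\<^sub>R X) Z = r * herm X Z" "herm Z (r *\<^sub>R X) = r * herm Z X"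
  "herm 0 Z = 0" "herm Z 0 = 0"
  by (simp_all add: herm_def sum.distrib sum_distrib_left algebra_simps sum_negf scaleR_conv_of_real[where 'a=complex])

lemma sympl_lin [simp]:
  "sympl (X + Y) Z = sympl X Z + sympl Y Z" "sympl Z (X + Y) = sympl Z X + sympl Z Y"
  "sympl (c *s X) Z = c * sympl X Z" "sympl Z (c *s X) = c * sympl Z X"
  "sympl (- X) Z = - sympl X Z" "sympl Z (- X) = - sympl Z X"
  "sympl (r *\<^sub>R X) Z = r * sympl X Z" "sympl Z (r *\<^sub>R X) = r * sympl Z X"
  "sympl 0 Z = 0" "sympl Z 0 = 0"
  by (simp_all add: sympl_def sum.distrib sum_distrib_left algebra_simps
      sum_negf scaleR_conv_of_real[where 'a=complex] sum_subtractf)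

lemma scoord_scale [simp]: "scoord (c *s X) i = c * scoord X i"
  by (simp add: scoord_def)

text \<open>Passing from the entries of the \<open>E\<close> part to \<open>scoord\<close> is a
  signed permutation, which preserves the Hermitian form.\<close>

lemma sum_scoord_cnj_scoord: "(\<Sum>i\<in>UNIV. scoord X i * cnj (scoord Y i)) = herm X Y"
  by (simp add: sum_idxE scoord_eq herm_def add.commute)

lemma inner_herm: "X \<bullet> Y = Re (herm X Y + X $ None * cnj (Y $ None))"
  by (simp add: inner_vec_def sum_idxT inner_complex_def herm_def)

lemma two_form_herm: "two_form A X Y = Re (herm (A *v X) Y + (A *v X) $ None * cnj (Y $ None))"
  by (simp add: two_form_def inner_herm)

section \<open>Curvature tensors and the Bianchi identity\<close>

text \<open>A two-form of type (1,1): the index \<open>i\<close> enters complex linearly through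
  \<open>sympl\<close>, the index \<open>j\<close> antilinearly through \<open>herm\<close>.
  Symmetrised in \<open>i\<close> and \<open>j\<close> it becomes
  \<open>sp_form (bvec i) (bvec j)\<close>.\<close>

definition chi :: "'n::finite idxE \<Rightarrow> 'n idxE \<Rightarrow> 'n T \<Rightarrow> 'n T \<Rightarrow> complex" where
  "chi i j X Y = scoord X i * cnj (Y $ Some j) - scoord Y i * cnj (X $ Some j)"

definition sp_form :: "'n::finite T \<Rightarrow> 'n T \<Rightarrow> 'n T \<Rightarrow> 'n T \<Rightarrow> complex" where
  "sp_form u v X Y = sympl u X * herm v Y - sympl u Y * herm v X + sympl v X * herm u Y - sympl v Y * herm u X"

definition eval4 :: "'i::finite ctensor4 \<Rightarrow> ('i \<Rightarrow> complex) \<Rightarrow> ('i \<Rightarrow> complex) \<Rightarrow> ('i \<Rightarrow> complex) \<Rightarrow> ('i \<Rightarrow> complex) \<Rightarrow> complex" where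
  "eval4 t \<alpha> \<beta> \<gamma> \<delta> = (\<Sum>i\<in>UNIV. \<Sum>j\<in>UNIV. \<Sum>k\<in>UNIV. \<Sum>l\<in>UNIV. t i j k l * \<alpha> i * \<beta> j * \<gamma> k * \<delta> l)"

text \<open>For \<open>t\<close> in \<open>S4\<close> this is the (complexified) hyperkaehler
  curvature tensor attached to \<open>t\<close>; the symmetry of \<open>t\<close> takes over the
  symmetrisation of \<open>chi\<close> in each pair of indices.\<close>

definition hk_tensor :: "'n::finite idxE ctensor4 \<Rightarrow> 'n T \<Rightarrow> 'n T \<Rightarrow> 'n T \<Rightarrow> 'n T \<Rightarrow> complex" where
  "hk_tensor t X Y Z W = (\<Sum>i\<in>UNIV. \<Sum>j\<in>UNIV. \<Sum>k\<in>UNIV. \<Sum>l\<in>UNIV. t i j k l * (chi i j X Y * chi k l Z W))"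

lemma eval4_commute:
  assumes "t \<in> S4"
  shows "eval4 t \<beta> \<alpha> \<gamma> \<delta> = eval4 t \<alpha> \<beta> \<gamma> \<delta>" "eval4 t \<alpha> \<gamma> \<beta> \<delta> = eval4 t \<alpha> \<beta> \<gamma> \<delta>"
    "eval4 t \<alpha> \<beta> \<delta> \<gamma> = eval4 t \<alpha> \<beta> \<gamma> \<delta>"
proof -
  have t: "t i j k l = t j i k l" "t i j k l = t i k j l" "t i j k l = t i j l k" for i j k l
    using assms unfolding S4_def by blast+
  show "eval4 t \<beta> \<alpha> \<gamma> \<delta> = eval4 t \<alpha> \<beta> \<gamma> \<delta>"
    unfolding eval4_def by (subst sum.swap, subst t(1)) (simp only: mult_ac)
  show "eval4 t \<alpha> \<gamma> \<beta> \<delta> = eval4 t \<alpha> \<beta> \<gamma> \<delta>"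
    unfolding eval4_def
    by (rule sum.cong[OF refl], subst sum.swap, subst t(2)) (simp only: mult_ac)
  show "eval4 t \<alpha> \<beta> \<delta> \<gamma> = eval4 t \<alpha> \<beta> \<gamma> \<delta>"
    unfolding eval4_def
    by (rule sum.cong[OF refl], rule sum.cong[OF refl], subst sum.swap, subst t(3)) (simp only: mult_ac)
qed

lemma hk_tensor_eval4:
  fixes X Y Z W :: "'n::finite T"
  defines "r \<equiv> \<lambda>X :: 'n T. \<lambda>i. cnj (X $ Some i)"
  shows "hk_tensor t X Y Z W =
    eval4 t (scoord X) (r Y) (scoord Z) (r W) - eval4 t (scoord Y) (r X) (scoord Z) (r W)
    - eval4 t (scoord X) (r Y) (scoord W) (r Z) + eval4 t (scoord Y) (r X) (scoord W) (r Z)"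
  unfolding hk_tensor_def eval4_def chi_def r_def
  by (simp add: algebra_simps sum.distrib sum_subtractf)

section \<open>The tensor spanning the trivial summand, and the Bianchi identities\<close>

definition u_form :: "'n::finite T \<Rightarrow> 'n T \<Rightarrow> real" where
  "u_form X Y = Im (herm X Y) + 2 * Im (X $ None * cnj (Y $ None))"

text \<open>The Casimir element of sp(n) in closed form; \<open>casimir_sp_form\<close> exhibits it
  as a sum over pairs of basis vectors.\<close>

definition casimir :: "'n::finite tensor4" where
  "casimir X Y Z W = Re (herm X Z * herm W Y - herm X W * herm Z Y
     + sympl W X * cnj (sympl Y Z) - sympl Z X * cnj (sympl Y W))"

text \<open>
  The coefficients are forced by the terms of \<open>\<sigma>\<close> with two arguments in the last coordinate and by
  the terms with none; in the latter the products of \<open>Im h\<close> cancel and those of \<open>\<omega>\<close> remain.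
\<close>

definition torsion_curv :: "'n::finite tensor4" where
  "torsion_curv X Y Z W = - (u_form X Y * u_form Z W) - casimir X Y Z W / 2"

lemma Theta\<^sub>0_eq:
  "Theta\<^sub>0 X Y Z = Re (sympl X Y * cnj (Z $ None) + sympl Y Z * cnj (X $ None) + sympl Z X * cnj (Y $ None)) / sqrt 2"
  by (simp add: Theta\<^sub>0_def T\<^sub>0_def wedge_2_1_def \<omega>\<^sub>0_sympl e_form_def add_divide_distrib diff_divide_distrib
      Re_divide_of_real Im_divide_of_real mult.commute)

text \<open>Read off from \<open>Theta\<^sub>0_eq\<close>: \<open>sympl X Y\<close> sits in the last
  coordinate, and the other two terms are conjugated so that \<open>Z\<close> occurs antilinearly,
  as it does in the inner product.\<close>

definition torsion_vec :: "'n::finite T \<Rightarrow> 'n T \<Rightarrow> 'n T" where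
  "torsion_vec X Y = (1 / sqrt 2) *\<^sub>R (\<chi> i. case i of None \<Rightarrow> sympl X Y
     | Some p \<Rightarrow> Y $ None * cnj (scoord X p) - X $ None * cnj (scoord Y p))"

text \<open>The vector of \<open>E\<close> with entries \<open>cnj (scoord X p)\<close> is j X for
  the quaternionic structure j, which exchanges the roles of \<open>herm\<close> and
  \<open>sympl\<close>.\<close>

lemma herm_chi_scoord:
  "herm (\<chi> i. case i of None \<Rightarrow> c | Some p \<Rightarrow> a * cnj (scoord X p) - b * cnj (scoord Y p)) Z
     = a * cnj (sympl Z X) - b * cnj (sympl Z Y)"
  by (simp add: herm_def sympl_scoord sum_distrib_left sum_subtractf algebra_simps)

lemma sympl_chi_scoord:
  "sympl (\<chi> i. case i of None \<Rightarrow> c | Some p \<Rightarrow> a * cnj (scoord X p) - b * cnj (scoord Y p)) Z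
     = a * herm Z X - b * herm Z Y"
  by (simp add: sympl_scoord sum_scoord_cnj_scoord[symmetric] sum_distrib_left sum_subtractf algebra_simps)

lemma vec_of_form_Theta\<^sub>0: "vec_of_form Theta\<^sub>0 X Y = torsion_vec X Y"
proof -
  have *: "torsion_vec X Y \<bullet> Z = Theta\<^sub>0 X Y Z" for Z
    by (simp add: torsion_vec_def inner_herm Theta\<^sub>0_eq herm_chi_scoord)
       (simp add: sympl_commute[of Y Z] algebra_simps add_divide_distrib diff_divide_distrib)
  show ?thesis
    unfolding vec_of_form_def
    by (rule the_equality) (metis * vector_eq_rdot)+
qed

lemma inner_torsion_vec:
  "torsion_vec X Y \<bullet> torsion_vec Z W = Re (sympl X Y * cnj (sympl Z W)
     + Y $ None * cnj (W $ None) * herm Z X - Y $ None * cnj (Z $ None) * herm W X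
     - X $ None * cnj (W $ None) * herm Z Y + X $ None * cnj (Z $ None) * herm W Y) / 2"
proof -
  have "(1 / sqrt 2) *\<^sub>R U \<bullet> (1 / sqrt 2) *\<^sub>R V = (U \<bullet> V) / 2" for U V :: "'a T"
    by simp
  then show ?thesis
    by (simp only: torsion_vec_def inner_herm herm_chi_scoord sympl_chi_scoord vec_lambda_beta option.case)
       (simp add: herm_commute[of X] herm_commute[of Y] algebra_simps)
qed

text \<open>Both sides are polynomials in the values of \<open>herm\<close>, \<open>sympl\<close>,
  the last coordinates and their conjugates. Once each pair of arguments is brought into a fixed
  order, the identity is one of polynomials.\<close>

lemma bianchi_torsion_curv: "bianchi torsion_curv = fscale 2 (sigma Theta\<^sub>0)"
proof (intro ext)
  fix X Y Z W :: "'a T"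
  show "bianchi torsion_curv X Y Z W = fscale 2 (sigma Theta\<^sub>0) X Y Z W"
    unfolding bianchi_def fscale_def sigma_def torsion_curv_def casimir_def u_form_def
      vec_of_form_Theta\<^sub>0 inner_torsion_vec
    using herm_commute[of X Y] herm_commute[of X Z] herm_commute[of X W] herm_commute[of Y Z]
      herm_commute[of Y W] herm_commute[of Z W]
      sympl_commute[of X Y] sympl_commute[of X Z] sympl_commute[of X W] sympl_commute[of Y Z]
      sympl_commute[of Y W] sympl_commute[of Z W]
    by (simp add: field_simps)
qed

text \<open>By symmetry of \<open>t\<close>, each of the twelve terms depends only on which two
  arguments enter through \<open>scoord\<close>. Every such choice occurs twice, with opposite
  signs.\<close>

lemma bianchi_hk_tensor:
  assumes "t \<in> S4"
  shows "hk_tensor t X Y Z W + hk_tensor t Y Z X W + hk_tensor t Z X Y W = 0"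
proof -
  note c = eval4_commute[OF assms]
  let ?r = "\<lambda>X i. cnj (X $ Some i)"
  have "eval4 t (scoord A) (?r B) (scoord C) (?r D) = eval4 t (scoord A) (scoord C) (?r B) (?r D)"
    "eval4 t (scoord A) (scoord C) (?r B) (?r D) = eval4 t (scoord C) (scoord A) (?r B) (?r D)"
    "eval4 t (scoord A) (scoord C) (?r B) (?r D) = eval4 t (scoord A) (scoord C) (?r D) (?r B)"
    for A B C D by (simp_all only: c(1), simp_all only: c(2), simp_all only: c(3))
  note * = this
  show ?thesis
    unfolding hk_tensor_eval4
    unfolding *(1)
    using *(2)[of X Z Y W] *(2)[of Y Z X W] *(2)[of X Y Z W]
      *(3)[of X W Y Z] *(3)[of Y W X Z] *(3)[of Z W X Y]
    by (simp add: algebra_simps)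
qed

section \<open>Action of the group\<close>

definition sum4 :: "('i::finite \<Rightarrow> 'i \<Rightarrow> 'i \<Rightarrow> 'i \<Rightarrow> complex) \<Rightarrow> complex" where
  "sum4 f = (\<Sum>i\<in>UNIV. \<Sum>j\<in>UNIV. \<Sum>k\<in>UNIV. \<Sum>l\<in>UNIV. f i j k l)"

lemma sum4_eq: "sum4 f = (\<Sum>(i, j, k, l)\<in>UNIV. f i j k l)"
  by (simp add: sum4_def sum.cartesian_product)

lemma sum4_swap: "sum4 (\<lambda>i j k l. sum4 (\<lambda>p q r s. f i j k l p q r s)) = sum4 (\<lambda>p q r s. sum4 (\<lambda>i j k l. f i j k l p q r s))"
  unfolding sum4_eq case_prod_beta by (rule sum.swap)

lemma sum4_prod: "sum4 (\<lambda>i j k l. c * (f i * g j * h k * m l)) = c * (sum f UNIV * sum g UNIV * sum h UNIV * sum m UNIV)"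
  by (simp add: sum4_def sum_distrib_left[symmetric] sum_distrib_right[symmetric])

text \<open>Acting on \<open>t\<close> amounts to applying the transpose of \<open>a\<close> to each
  of the four covectors.\<close>

lemma eval4_act4:
  "eval4 (act4 a t) \<alpha> \<beta> \<gamma> \<delta> = eval4 t (\<lambda>i. \<Sum>j\<in>UNIV. a $ j $ i * \<alpha> j) (\<lambda>i. \<Sum>j\<in>UNIV. a $ j $ i * \<beta> j)
     (\<lambda>i. \<Sum>j\<in>UNIV. a $ j $ i * \<gamma> j) (\<lambda>i. \<Sum>j\<in>UNIV. a $ j $ i * \<delta> j)"
proof -
  have "eval4 (act4 a t) \<alpha> \<beta> \<gamma> \<delta> = sum4 (\<lambda>i j k l. sum4 (\<lambda>p q r s.
      t p q r s * ((a $ i $ p * \<alpha> i) * (a $ j $ q * \<beta> j) * (a $ k $ r * \<gamma> k) * (a $ l $ s * \<delta> l))))"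
    by (simp add: eval4_def act4_def sum4_def sum_distrib_right sum_distrib_left mult_ac)
  also have "\<dots> = eval4 t (\<lambda>i. \<Sum>j\<in>UNIV. a $ j $ i * \<alpha> j) (\<lambda>i. \<Sum>j\<in>UNIV. a $ j $ i * \<beta> j)
     (\<lambda>i. \<Sum>j\<in>UNIV. a $ j $ i * \<gamma> j) (\<lambda>i. \<Sum>j\<in>UNIV. a $ j $ i * \<delta> j)"
    by (subst sum4_swap, subst sum4_prod) (simp add: sum4_def eval4_def mult_ac)
  finally show ?thesis .
qed

text \<open>With \<open>c = cnj b\<close> and \<open>d = b\<close> for \<open>b\<close> in
  \<open>U1\<close> the factor is 1: this is the reason why U(1) acts trivially on the summand from
  \<open>S4\<close>.\<close>

lemma eval4_scale:
  "eval4 t (\<lambda>i. c * \<alpha> i) (\<lambda>i. d * \<beta> i) (\<lambda>i. c * \<gamma> i) (\<lambda>i. d * \<delta> i) = (c * d)\<^sup>2 * eval4 t \<alpha> \<beta> \<gamma> \<delta>"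
  by (simp add: eval4_def sum_distrib_left power2_eq_square mult_ac)

lemma act4_S4:
  assumes "t \<in> S4"
  shows "act4 a t \<in> S4"
proof -
  \<comment> \<open>The components are values of the multilinear form of \<open>t\<close> on the
    rows of \<open>a\<close>, so they inherit its symmetry.\<close>
  have "act4 a t i j k l = eval4 t (($) (a $ i)) (($) (a $ j)) (($) (a $ k)) (($) (a $ l))" for i j k l
    by (simp add: act4_def eval4_def mult_ac)
  then show ?thesis
    using eval4_commute[OF assms] by (simp add: S4_def)
qed

section \<open>Block diagonal matrices and the group structure\<close>

lemma block_diag_nth [simp]:
  "block_diag A c $ None $ None = c" "block_diag A c $ Some p $ Some q = A $ p $ q"
  "block_diag A c $ None $ Some q = 0" "block_diag A c $ Some p $ None = 0"
  by (simp_all add: block_diag_def)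

lemma idxT_matrix_eqI:
  assumes "A $ None $ None = B $ None $ None" "\<And>p q. A $ Some p $ Some q = B $ Some p $ Some q"
    "\<And>q. A $ None $ Some q = B $ None $ Some q" "\<And>p. A $ Some p $ None = B $ Some p $ None"
  shows "A = B"
  using assms by (simp add: vec_eq_iff) (metis option.exhaust)

lemma block_diag_mult: "block_diag A c ** block_diag B d = block_diag (A ** B) (c * d)"
  by (rule idxT_matrix_eqI) (simp_all add: matrix_matrix_mult_def sum_idxT)

lemma block_diag_one: "block_diag (mat 1) 1 = mat 1"
  by (rule idxT_matrix_eqI) (simp_all add: mat_def)

lemma cadjoint_block_diag: "cadjoint (block_diag A c) = block_diag (cadjoint A) (cnj c)"
  by (rule idxT_matrix_eqI) (simp_all add: cadjoint_def)

lemma cadjoint_mult: "cadjoint (A ** B) = cadjoint B ** cadjoint A"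
  by (simp add: cadjoint_def matrix_matrix_mult_def vec_eq_iff mult.commute)

lemma cadjoint_mat: "cadjoint (mat c) = mat (cnj c)"
  by (auto simp add: cadjoint_def mat_def vec_eq_iff)

lemma mat_mult_mat: "mat c ** mat d = (mat (c * d) :: complex^'m^'m)"
  by (simp add: vec_eq_iff matrix_mult_mat_nth) (simp add: mat_def)

lemma mat_commute: "mat c ** A = A ** (mat c :: complex^'m^'m)"
  by (simp add: vec_eq_iff matrix_mult_mat_nth)
     (simp add: matrix_matrix_mult_def mat_def if_distrib if_distribR mult.commute cong: if_cong)

lemma block_diag_mult_vec:
  "(block_diag A c *v X) $ None = c * X $ None"
  "(block_diag A c *v X) $ Some p = (\<Sum>q\<in>UNIV. A $ p $ q * X $ Some q)"
  by (simp_all add: matrix_vector_mult_def sum_idxT)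

lemma rho_mult_vec:
  "(\<rho> a b *v X) $ None = b\<^sup>2 * X $ None"
  "(\<rho> a b *v X) $ Some p = b * (\<Sum>q\<in>UNIV. a $ p $ q * X $ Some q)"
  by (simp_all add: \<rho>_def block_diag_mult_vec matrix_mult_mat_nth sum_distrib_left mult_ac)

lemma rho_mult: "\<rho> a b ** \<rho> a' b' = \<rho> (a ** a') (b * b')"
proof -
  have "(a ** mat b) ** (a' ** mat b') = a ** (mat b ** a') ** mat b'"
    by (simp only: matrix_mul_assoc)
  then have "(a ** mat b) ** (a' ** mat b') = (a ** a') ** mat (b * b')"
    by (simp only: mat_commute[of b a'] matrix_mul_assoc flip: mat_mult_mat)
  then show ?thesis
    by (simp add: \<rho>_def block_diag_mult power_mult_distrib)
qed

lemma unitary_group_mult: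
  assumes "A \<in> unitary_group" "B \<in> unitary_group"
  shows "A ** B \<in> unitary_group"
proof -
  have "cadjoint B ** cadjoint A ** (A ** B) = cadjoint B ** (cadjoint A ** A) ** B"
    "A ** B ** (cadjoint B ** cadjoint A) = A ** (B ** cadjoint B) ** cadjoint A"
    by (simp_all only: matrix_mul_assoc)
  with assms show ?thesis by (simp add: unitary_group_def cadjoint_mult)
qed

lemma U1_cnj: "b \<in> U1 \<Longrightarrow> cnj b * b = 1" "b \<in> U1 \<Longrightarrow> b * cnj b = 1"
  by (simp_all add: U1_def complex_norm_square[symmetric] mult.commute)

lemma mat_unitary: "b \<in> U1 \<Longrightarrow> mat b \<in> unitary_group"
  by (simp add: unitary_group_def cadjoint_mat mat_mult_mat U1_cnj)

lemma rho_unitary: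
  assumes "a \<in> Sp" "b \<in> U1"
  shows "\<rho> a b \<in> unitary_group"
proof -
  have "a ** mat b \<in> unitary_group"
    using assms by (simp add: Sp_def unitary_group_mult mat_unitary)
  moreover have "cnj (b\<^sup>2) * b\<^sup>2 = 1"
    using U1_cnj[OF assms(2)] by (simp flip: power_mult_distrib)
  ultimately show ?thesis
    by (simp add: \<rho>_def unitary_group_def cadjoint_block_diag block_diag_mult block_diag_one mult.commute)
qed

lemma matrix_inv_unitary:
  assumes "h \<in> unitary_group"
  shows "matrix_inv h = cadjoint h"
proof -
  have h: "cadjoint h ** h = mat 1" "h ** cadjoint h = mat 1"
    using assms by (auto simp: unitary_group_def)
  have "h ** matrix_inv h = mat 1 \<and> matrix_inv h ** h = mat 1"
    unfolding matrix_inv_def by (rule someI[where x = "cadjoint h"]) (simp add: h)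
  then show ?thesis
    by (metis h matrix_mul_assoc matrix_mul_lid matrix_mul_rid)
qed

lemma Sp_sympl: "a \<in> Sp \<longleftrightarrow> a \<in> unitary_group \<and> (\<forall>X Y. sympl (block_diag a 1 *v X) (block_diag a 1 *v Y) = sympl X Y)"
  by (simp add: Sp_def \<omega>\<^sub>0_sympl)

lemma Sp_mult:
  assumes "a \<in> Sp" "a' \<in> Sp"
  shows "a ** a' \<in> Sp"
proof -
  have "block_diag (a ** a') 1 *v X = block_diag a 1 *v (block_diag a' 1 *v X)" for X :: "'a T"
    by (simp add: matrix_vector_mul_assoc block_diag_mult)
  with assms show ?thesis by (simp add: Sp_sympl unitary_group_mult)
qed

lemma SpU1_mult:
  assumes "h \<in> SpU1" "k \<in> SpU1"
  shows "h ** k \<in> SpU1"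
proof -
  obtain a b a' b' where "h = \<rho> a b" "k = \<rho> a' b'" "a \<in> Sp" "b \<in> U1" "a' \<in> Sp" "b' \<in> U1"
    using assms unfolding SpU1_def by blast
  moreover from this have "b * b' \<in> U1" by (simp add: U1_def norm_mult)
  ultimately show ?thesis
    unfolding SpU1_def using Sp_mult rho_mult by blast
qed

lemma one_Sp: "mat 1 \<in> Sp"
  by (simp add: Sp_sympl block_diag_one) (simp add: unitary_group_def cadjoint_mat)

lemma one_SpU1: "mat 1 \<in> SpU1"
proof -
  have "mat 1 = \<rho> (mat 1) 1" by (simp add: \<rho>_def block_diag_one)
  moreover have "1 \<in> U1" by (simp add: U1_def)
  ultimately show ?thesis unfolding SpU1_def using one_Sp by blast
qed

lemma SpU1_unitary: "h \<in> SpU1 \<Longrightarrow> h \<in> unitary_group"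
  unfolding SpU1_def using rho_unitary by blast

lemma sum_cnj_mult_vec: "(\<Sum>p\<in>UNIV. (A *v x) $ p * cnj (y $ p)) = (\<Sum>p\<in>UNIV. x $ p * cnj ((cadjoint A *v y) $ p))"
  by (simp add: matrix_vector_mult_def cadjoint_def sum_distrib_left sum_distrib_right mult_ac)
     (subst sum.swap, simp)

lemma sympl_rho:
  assumes "a \<in> Sp"
  shows "sympl (\<rho> a b *v X) (\<rho> a b *v Y) = b\<^sup>2 * sympl X Y"
proof -
  \<comment> \<open>The form \<open>sympl\<close> sees only the \<open>E\<close> coordinates, on
    which the matrix is \<open>b\<close> times the symplectic one.\<close>
  have e: "(\<rho> a b *v X) $ Some p = (b *s (block_diag a 1 *v X)) $ Some p" for X p
    by (simp add: rho_mult_vec block_diag_mult_vec)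
  have "sympl (\<rho> a b *v X) (\<rho> a b *v Y) = sympl (b *s (block_diag a 1 *v X)) (b *s (block_diag a 1 *v Y))"
    unfolding sympl_def e ..
  with assms show ?thesis by (simp add: Sp_sympl power2_eq_square)
qed

lemma herm_rho:
  assumes "a \<in> Sp" "b \<in> U1"
  shows "herm (\<rho> a b *v X) (\<rho> a b *v Y) = herm X Y"
proof -
  \<comment> \<open>Unitarity preserves the Hermitian product of all of \<open>T\<close>; the last
    coordinate contributes the same to both sides because the square of \<open>b\<close> has modulus
    1.\<close>
  have "(\<Sum>p\<in>UNIV. (\<rho> a b *v X) $ p * cnj ((\<rho> a b *v Y) $ p)) = (\<Sum>p\<in>UNIV. X $ p * cnj (Y $ p))"
    using rho_unitary[OF assms] unfolding sum_cnj_mult_vec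
    by (simp add: matrix_vector_mul_assoc unitary_group_def)
  moreover have "b\<^sup>2 * (cnj b)\<^sup>2 = 1"
    using U1_cnj[OF assms(2)] by (simp flip: power_mult_distrib)
  ultimately show ?thesis
    by (simp add: sum_idxT herm_def rho_mult_vec mult_ac)
qed

text \<open>\<open>tensor_act\<close> pulls back along the inverse matrix. Its effect on forms and
  coordinates is found by applying the rules for the matrix itself to preimages.\<close>

locale rho_inverse =
  fixes a :: "'n::finite matE" and b :: complex
  assumes a: "a \<in> Sp" and b: "b \<in> U1"
begin

definition "\<iota> X = matrix_inv (\<rho> a b) *v X"

lemma rho_iota: "\<rho> a b *v \<iota> X = X"
  using rho_unitary[OF a b]
  by (simp add: \<iota>_def matrix_inv_unitary matrix_vector_mul_assoc unitary_group_def)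

lemma cnj_b: "cnj b * (b * c) = c"
  using U1_cnj[OF b] by (simp flip: mult.assoc)

lemma herm_iota: "herm (\<iota> X) (\<iota> Y) = herm X Y"
  using herm_rho[OF a b, of "\<iota> X" "\<iota> Y"] by (simp add: rho_iota)

lemma sympl_iota: "sympl (\<iota> X) (\<iota> Y) = cnj b ^ 2 * sympl X Y"
  using sympl_rho[OF a, of b "\<iota> X" "\<iota> Y"] by (simp add: rho_iota cnj_b power2_eq_square mult.assoc)

lemma nth_iota: "\<iota> X $ None = cnj b ^ 2 * X $ None"
  using rho_mult_vec(1)[of a b "\<iota> X"] by (simp add: rho_iota cnj_b power2_eq_square mult.assoc)

lemma rho_bvec: "(\<rho> a b *v bvec i) $ Some p = b * a $ p $ i"
  by (simp add: rho_mult_vec if_distrib if_distribR cong: if_cong)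

text \<open>Invariance of \<open>sympl\<close> trades the inverse for the transpose of
  \<open>a\<close>, the form that matches \<open>eval4_act4\<close>. The same is done with
  \<open>herm\<close> for the conjugated entries below.\<close>

lemma scoord_iota: "scoord (\<iota> X) i = cnj b * (\<Sum>j\<in>UNIV. a $ j $ i * scoord X j)"
proof -
  have "b\<^sup>2 * sympl (bvec i) (\<iota> X) = (\<Sum>j\<in>UNIV. b * a $ j $ i * scoord X j)"
    using sympl_rho[OF a, of b "bvec i" "\<iota> X"] by (simp add: rho_iota sympl_scoord rho_bvec)
  then have "cnj b * (cnj b * (b * (b * sympl (bvec i) (\<iota> X)))) = cnj b * (cnj b * (b * (\<Sum>j\<in>UNIV. a $ j $ i * scoord X j)))"
    by (simp add: sum_distrib_left power2_eq_square mult.assoc)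
  then show ?thesis by (simp add: cnj_b scoord_def mult.left_commute[of b "cnj b"])
qed

lemma cnj_nth_iota: "cnj (\<iota> X $ Some i) = b * (\<Sum>j\<in>UNIV. a $ j $ i * cnj (X $ Some j))"
  using herm_rho[OF a b, of "bvec i" "\<iota> X"]
  unfolding rho_iota herm_bvec by (simp add: herm_def rho_bvec sum_distrib_left mult_ac)

lemma hk_tensor_iota: "hk_tensor t (\<iota> X) (\<iota> Y) (\<iota> Z) (\<iota> W) = hk_tensor (act4 a t) X Y Z W"
proof -
  have s: "scoord (\<iota> X) = (\<lambda>i. cnj b * (\<Sum>j\<in>UNIV. a $ j $ i * scoord X j))" for X
    by (simp add: scoord_iota fun_eq_iff)
  show ?thesis
    by (simp only: hk_tensor_eval4 s cnj_nth_iota eval4_scale eval4_act4 U1_cnj[OF b] power_one mult_1)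
qed

lemma torsion_curv_iota: "torsion_curv (\<iota> X) (\<iota> Y) (\<iota> Z) (\<iota> W) = torsion_curv X Y Z W"
proof -
  \<comment> \<open>In \<open>torsion_curv\<close> each phase meets its own conjugate.\<close>
  have e: "cnj b ^ 2 * c * cnj (cnj b ^ 2 * d) = c * cnj d" for c d
    using U1_cnj[OF b] by (simp add: mult_ac flip: power_mult_distrib)
  show ?thesis
    by (simp only: torsion_curv_def u_form_def casimir_def herm_iota sympl_iota nth_iota e)
qed

end

section \<open>The Lie algebra\<close>

text \<open>The derivatives at the identity of the relations in \<open>SpU1_invariants\<close>,
  serving as an upper bound for the Lie algebra. Elements of the Lie algebra are produced separately
  from explicit curves.\<close>

definition spu1 :: "'n::finite matT set" where
  "spu1 = {A. (\<forall>p. A $ None $ Some p = 0 \<and> A $ Some p $ None = 0) \<and> Re (A $ None $ None) = 0 \<and>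
     (\<forall>X Y. herm (A *v X) Y + herm X (A *v Y) = 0) \<and>
     (\<forall>X Y. sympl (A *v X) Y + sympl X (A *v Y) = A $ None $ None * sympl X Y)}"

lemma bounded_bilinear_herm: "bounded_bilinear (herm :: 'n::finite T \<Rightarrow> _)"
  by (subst bilinear_conv_bounded_bilinear[symmetric])
     (simp add: bilinear_def linear_iff scaleR_conv_of_real[where 'a=complex])

lemma bounded_bilinear_sympl: "bounded_bilinear (sympl :: 'n::finite T \<Rightarrow> _)"
  by (subst bilinear_conv_bounded_bilinear[symmetric])
     (simp add: bilinear_def linear_iff scaleR_conv_of_real[where 'a=complex])

lemma scaleR_matrix_vector: "(r *\<^sub>R A) *v X = r *\<^sub>R (A *v X)"
  "A *v (r *\<^sub>R X) = r *\<^sub>R (A *v X)" for A :: "complex^'m^'k"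
  by (simp_all add: vec_eq_iff matrix_vector_mult_def scaleR_sum_right)

lemma scale_matrix_vector: "A *v (c *s X) = c *s (A *v X)" for A :: "complex^'m^'k"
  by (simp add: vec_eq_iff matrix_vector_mult_def sum_distrib_left mult_ac)

lemma has_vector_derivative_matrix_vector:
  fixes \<gamma> :: "real \<Rightarrow> complex^'m^'k"
  assumes "(\<gamma> has_vector_derivative A) (at t)"
  shows "((\<lambda>t. \<gamma> t *v X) has_vector_derivative A *v X) (at t)"
proof -
  have "linear (\<lambda>M :: complex^'m^'k. M *v X)"
    by (simp add: linear_iff matrix_vector_mult_add_rdistrib scaleR_matrix_vector)
  then show ?thesis
    using bounded_linear.has_vector_derivative[OF _ assms] by (simp add: linear_conv_bounded_linear)
qed

lemma has_vector_derivative_nth: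
  fixes f :: "real \<Rightarrow> 'a::real_normed_vector^'m"
  assumes "(f has_vector_derivative A) (at t)"
  shows "((\<lambda>t. f t $ i) has_vector_derivative A $ i) (at t)"
  using bounded_linear.has_vector_derivative[OF bounded_linear_vec_nth assms] .

lemma SpU1_invariants:
  assumes "h \<in> SpU1"
  shows "h $ None $ Some p = 0" "h $ Some p $ None = 0" "herm (h *v X) (h *v Y) = herm X Y"
    "sympl (h *v X) (h *v Y) = h $ None $ None * sympl X Y" "h $ None $ None * cnj (h $ None $ None) = 1"
proof -
  obtain a b where ab: "h = \<rho> a b" "a \<in> Sp" "b \<in> U1"
    using assms unfolding SpU1_def by blast
  show "h $ None $ Some p = 0" "h $ Some p $ None = 0"
    by (simp_all add: ab \<rho>_def)
  show "herm (h *v X) (h *v Y) = herm X Y"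
    using herm_rho ab by blast
  show "sympl (h *v X) (h *v Y) = h $ None $ None * sympl X Y"
    using sympl_rho[of a b X Y] ab by (simp add: \<rho>_def)
  show "h $ None $ None * cnj (h $ None $ None) = 1"
    using U1_cnj[OF ab(3)] by (simp add: ab \<rho>_def flip: power_mult_distrib)
qed

text \<open>Each invariant is constant along a curve in the group, or for \<open>sympl\<close>
  scales with the last diagonal entry. The product rule at 0 yields the linear relations.\<close>

lemma lie_algebra_SpU1_subset: "lie_algebra SpU1 \<subseteq> spu1"
proof
  fix A :: "'n::finite matT"
  assume "A \<in> lie_algebra SpU1"
  then obtain \<gamma> where \<gamma>: "\<gamma> t \<in> SpU1" and "\<gamma> 0 = mat 1" and d: "(\<gamma> has_vector_derivative A) (at 0)" for t
    unfolding lie_algebra_def by blast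
  note inv = SpU1_invariants[OF \<gamma>]
  have at0: "\<gamma> 0 *v X = X" for X using \<open>\<gamma> 0 = mat 1\<close> by simp
  note dv = has_vector_derivative_matrix_vector[OF d]
  note dn = has_vector_derivative_nth[OF has_vector_derivative_nth[OF d]]
  have zero: "D = 0" if "(f has_vector_derivative D) (at (0::real))" "\<And>t. f t = c" for f c and D :: complex
  proof -
    have "f = (\<lambda>_. c)" using that(2) by blast
    with that(1) show ?thesis
      using vector_derivative_unique_at has_vector_derivative_const by blast
  qed
  have "A $ None $ Some p = 0" "A $ Some p $ None = 0" for p
    using zero[OF dn] inv by blast+
  moreover have "herm (A *v X) Y + herm X (A *v Y) = 0" for X Y
    using zero[OF bounded_bilinear.has_vector_derivative[OF bounded_bilinear_herm dv dv] inv(3)]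
    by (simp add: at0 add.commute)
  moreover have "sympl (A *v X) Y + sympl X (A *v Y) = A $ None $ None * sympl X Y" for X Y
  proof -
    have "((\<lambda>t. \<gamma> t $ None $ None * sympl X Y) has_vector_derivative A $ None $ None * sympl X Y) (at 0)"
      using has_vector_derivative_mult_left[OF dn] by blast
    then have "((\<lambda>t. sympl (\<gamma> t *v X) (\<gamma> t *v Y)) has_vector_derivative A $ None $ None * sympl X Y) (at 0)"
      by (simp add: inv(4))
    from vector_derivative_unique_at[OF this bounded_bilinear.has_vector_derivative[OF bounded_bilinear_sympl dv dv]]
    show ?thesis by (simp add: at0 add.commute)
  qed
  moreover have "Re (A $ None $ None) = 0"
  proof -
    have "A $ None $ None + cnj (A $ None $ None) = 0"
      using zero[OF has_vector_derivative_mult[OF dn bounded_linear.has_vector_derivative[OF bounded_linear_cnj dn]] inv(5)]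
        \<open>\<gamma> 0 = mat 1\<close> by (simp add: mat_def add.commute)
    then show ?thesis by (simp add: complex_eq_iff)
  qed
  ultimately show "A \<in> spu1" by (simp add: spu1_def)
qed

lemma block_diag_inject: "block_diag A c = block_diag B d \<Longrightarrow> A = B"
  unfolding vec_eq_iff[of A B] vec_eq_iff[of "A $ _"] by (metis block_diag_nth(2))

text \<open>The criterion for the subgroup \<open>b = 1\<close>, in which the curves tangent to
  sp(n) run.\<close>

lemma SpU1I:
  assumes "M $ None $ None = 1" "\<And>p. M $ None $ Some p = 0" "\<And>p. M $ Some p $ None = 0"
    and "M \<in> unitary_group" and "\<And>X Y. sympl (M *v X) (M *v Y) = sympl X Y"
  shows "M \<in> SpU1"
proof -
  define a where "a = (\<chi> p q. M $ Some p $ Some q)"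
  have M: "M = block_diag a 1"
    using assms(1-3) by (intro idxT_matrix_eqI) (simp_all add: a_def)
  have "block_diag (cadjoint a ** a) 1 = block_diag (mat 1) 1" "block_diag (a ** cadjoint a) 1 = block_diag (mat 1) 1"
    using assms(4) by (simp_all add: M unitary_group_def cadjoint_block_diag block_diag_mult block_diag_one)
  then have "cadjoint a ** a = mat 1" "a ** cadjoint a = mat 1"
    by (auto dest: block_diag_inject)
  then have "a \<in> Sp"
    using assms(5) by (simp add: Sp_sympl M unitary_group_def)
  moreover have "M = \<rho> a 1" by (simp add: \<rho>_def M)
  moreover have "1 \<in> U1" by (simp add: U1_def)
  ultimately show ?thesis unfolding SpU1_def by blast
qed

section \<open>Explicit elements of sp(n) as tangent vectors\<close>

definition sp_gen :: "'n::finite T \<Rightarrow> 'n matT" where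
  "sp_gen v = block_diag (\<chi> p q. cnj (scoord v p) * cnj (v $ Some q) - v $ Some p * scoord v q) 0"

text \<open>With the quaternionic structure j, the map on \<open>E\<close> sends X to h(X, v) j v +
  \<omega>(v, X) v. It is the real element of sp(n) attached to the square of \<open>v\<close> in
  the second symmetric power of \<open>E\<close>.\<close>

lemma sp_gen_vec:
  "(sp_gen v *v X) $ None = 0"
  "(sp_gen v *v X) $ Some p = herm X v * cnj (scoord v p) + sympl v X * v $ Some p"
proof -
  have "sympl v X = - sympl X v" by (rule sympl_commute)
  then show "(sp_gen v *v X) $ Some p = herm X v * cnj (scoord v p) + sympl v X * v $ Some p"
    by (simp add: sp_gen_def block_diag_mult_vec herm_def sympl_scoord[of X] sum_distrib_left
        sum_subtractf algebra_simps)
qed (simp add: sp_gen_def block_diag_mult_vec)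

lemma sum_cnj_scoord: "(\<Sum>p\<in>UNIV. cnj (scoord v p) * cnj (Y $ Some p)) = cnj (sympl Y v)"
  by (simp add: sympl_scoord mult.commute)

lemma herm_sp_gen: "herm (sp_gen v *v X) Y = herm X v * cnj (sympl Y v) + sympl v X * herm v Y"
  by (simp add: herm_def[of _ Y] sp_gen_vec sum_cnj_scoord[symmetric] sum.distrib sum_distrib_left algebra_simps)

lemma sympl_sp_gen: "sympl (sp_gen v *v X) Y = herm X v * herm Y v + sympl v X * sympl v Y"
  by (simp add: sympl_scoord[of _ Y] sum_scoord_cnj_scoord[symmetric, of Y] sp_gen_vec
      sum.distrib sum_distrib_left algebra_simps)

lemma sp_gen_sympl: "sympl X (sp_gen v *v Y) = - sympl (sp_gen v *v X) Y"
  unfolding sympl_commute[of X "sp_gen v *v Y"] sympl_sp_gen by (simp add: mult.commute)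

lemma sympl_self [simp]: "sympl v v = 0"
  using sympl_commute[of v v] by (simp add: complex_eq_iff)

lemma herm_self: "herm v v = complex_of_real (\<Sum>p\<in>UNIV. (norm (v $ Some p))\<^sup>2)"
  by (simp only: herm_def of_real_sum complex_norm_square)

text \<open>The image lies in the span of v and j v. There the map sends v to N j v and j v to -N v,
  so its square is minus the square of N.\<close>

lemma sp_gen_cube:
  fixes v :: "'n::finite T"
  defines "N \<equiv> \<Sum>p\<in>UNIV. (norm (v $ Some p))\<^sup>2"
  shows "sp_gen v *v (sp_gen v *v (sp_gen v *v X)) = - (N\<^sup>2 *\<^sub>R (sp_gen v *v X))"
proof -
  have N: "herm v v = of_real N" by (simp add: N_def herm_self)
  have h: "herm (sp_gen v *v X) v = of_real N * sympl v X" for X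
    by (simp add: herm_sp_gen N)
  have s: "sympl v (sp_gen v *v X) = - of_real N * herm X v" for X
    by (simp add: sp_gen_sympl sympl_sp_gen N)
  show ?thesis
    by (simp add: vec_eq_iff split_option_all sp_gen_vec h s power2_eq_square scaleR_conv_of_real[where 'a=complex] algebra_simps)
qed

lemma two_form_sp_gen: "two_form (sp_gen v) X Y = Re (sp_form v v X Y) / 2"
  by (simp add: two_form_herm sp_gen_vec(1) herm_sp_gen sp_form_def sympl_commute[of Y v] herm_commute[of X v])

lemma cadjoint_sp_gen: "cadjoint (sp_gen v) = - sp_gen v"
  by (rule idxT_matrix_eqI) (simp_all add: sp_gen_def cadjoint_def mult.commute)

lemma cadjoint_add: "cadjoint (A + B) = cadjoint A + cadjoint B"
  by (simp add: cadjoint_def vec_eq_iff)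

lemma cadjoint_scaleR: "cadjoint (r *\<^sub>R A) = r *\<^sub>R cadjoint A"
  by (simp add: cadjoint_def vec_eq_iff)

text \<open>
  Since \<open>A\<^sup>3 = -N\<^sup>2A\<close> for \<open>A = sp_gen v\<close>, the matrix \<open>1 + cA + dA\<^sup>2\<close> is inverse to its adjoint
  \<open>1 - cA + dA\<^sup>2\<close> as soon as \<open>2d = c\<^sup>2 + d\<^sup>2N\<^sup>2\<close>. This conic has a rational parametrisation, so no matrix
  exponential is needed.
\<close>

definition sp_curve :: "real \<Rightarrow> real \<Rightarrow> 'n::finite T \<Rightarrow> 'n matT" where
  "sp_curve c d v = mat 1 + c *\<^sub>R sp_gen v + d *\<^sub>R (sp_gen v ** sp_gen v)"

lemma sp_curve_vec:
  "sp_curve c d v *v X = X + c *\<^sub>R (sp_gen v *v X) + d *\<^sub>R (sp_gen v *v (sp_gen v *v X))"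
  by (simp add: sp_curve_def matrix_vector_mult_add_rdistrib scaleR_matrix_vector matrix_vector_mul_assoc)

lemma sp_curve_inverse:
  fixes v :: "'n::finite T"
  defines "N \<equiv> \<Sum>p\<in>UNIV. (norm (v $ Some p))\<^sup>2"
  assumes "2 * d = c\<^sup>2 + d\<^sup>2 * N\<^sup>2"
  shows "sp_curve c d v *v (sp_curve (- c) d v *v X) = X"
proof -
  let ?B = "\<lambda>X. sp_gen v *v X"
  have cube: "?B (?B (?B X)) = (- (N\<^sup>2)) *\<^sub>R ?B X" for X
    using sp_gen_cube[of v X] unfolding N_def by simp
  have "sp_curve c d v *v (sp_curve (- c) d v *v X) = X + (2 * d - c\<^sup>2 - d\<^sup>2 * N\<^sup>2) *\<^sub>R ?B (?B X)"
    unfolding sp_curve_vec matrix_vector_right_distrib scaleR_matrix_vector cube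
    by (simp add: vec_eq_iff scaleR_conv_of_real[where 'a=complex] algebra_simps power2_eq_square)
  then show ?thesis using assms(2) by simp
qed

lemma sympl_diff [simp]: "sympl (X - Y) Z = sympl X Z - sympl Y Z" "sympl Z (X - Y) = sympl Z X - sympl Z Y"
  by (simp_all add: sympl_def sum_subtractf sum.distrib algebra_simps)

lemma sp_curve_SpU1:
  fixes v :: "'n::finite T"
  assumes "2 * d = c\<^sup>2 + d\<^sup>2 * (\<Sum>p\<in>UNIV. (norm (v $ Some p))\<^sup>2)\<^sup>2"
  shows "sp_curve c d v \<in> SpU1"
proof (rule SpU1I)
  have adj: "cadjoint (sp_curve c d v) = sp_curve (- c) d v" for c
    by (simp add: sp_curve_def cadjoint_add cadjoint_scaleR cadjoint_mult cadjoint_sp_gen cadjoint_mat)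
       (simp add: vec_eq_iff matrix_matrix_mult_def)
  have inv: "sp_curve c d v ** sp_curve (- c) d v = mat 1" "sp_curve (- c) d v ** sp_curve c d v = mat 1"
    using sp_curve_inverse[of d c v] sp_curve_inverse[of d "- c" v] assms
    by (simp_all add: matrix_eq flip: matrix_vector_mul_assoc)
  show "sp_curve c d v \<in> unitary_group"
    by (simp add: unitary_group_def adj inv)
  have "sympl X (sp_curve c d v *v Y) = sympl (sp_curve (- c) d v *v X) Y" for X Y
    by (simp add: sp_curve_vec sp_gen_sympl)
  then show "sympl (sp_curve c d v *v X) (sp_curve c d v *v Y) = sympl X Y" for X Y
    by (simp add: matrix_vector_mul_assoc inv)
  show "sp_curve c d v $ None $ None = 1" "sp_curve c d v $ None $ Some p = 0" "sp_curve c d v $ Some p $ None = 0" for p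
    by (simp_all add: sp_curve_def mat_def sp_gen_def block_diag_mult)
qed

lemma sp_gen_lie_algebra: "sp_gen v \<in> lie_algebra SpU1"
proof -
  define N where "N = (\<Sum>p\<in>UNIV. (norm (v $ Some p))\<^sup>2)"
  \<comment> \<open>The line d = (t/2) c through the origin meets the conic again at c = t / D,
    which gives \<open>c\<close> and \<open>d\<close>. At t = 0 the derivatives are 1 and 0.\<close>
  define D where "D t = 1 + N\<^sup>2 * t\<^sup>2 / 4" for t
  define c where "c t = t / D t" for t
  define d where "d t = t\<^sup>2 / 2 / D t" for t
  have D: "D t > 0" for t
    by (simp add: D_def add_pos_nonneg)
  have D': "(D has_real_derivative N\<^sup>2 * t / 2) (at t)" for t
    unfolding D_def by (auto intro!: derivative_eq_intros)
  define c1 where "c1 t = (D t - t * (N\<^sup>2 * t / 2)) / (D t)\<^sup>2" for t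
  define d1 where "d1 t = (t * D t - t\<^sup>2 / 2 * (N\<^sup>2 * t / 2)) / (D t)\<^sup>2" for t
  have c': "(c has_real_derivative c1 t) (at t)" for t
    unfolding c_def c1_def using D[of t] by (auto intro!: derivative_eq_intros D' simp: power2_eq_square)
  have d': "(d has_real_derivative d1 t) (at t)" for t
    unfolding d_def d1_def using D[of t] by (auto intro!: derivative_eq_intros D' simp: power2_eq_square field_simps)
  have "2 * d t = (c t)\<^sup>2 + (d t)\<^sup>2 * N\<^sup>2" for t
  proof -
    have cD: "c t * D t = t" and dD: "d t * D t = t\<^sup>2 / 2"
      using D[of t] by (simp_all add: c_def d_def)
    have "2 * d t * (D t)\<^sup>2 = 2 * (d t * D t) * D t"
      by (simp add: power2_eq_square)
    also have "\<dots> = (c t * D t)\<^sup>2 + (d t * D t)\<^sup>2 * N\<^sup>2"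
      unfolding cD dD by (simp add: D_def algebra_simps power2_eq_square)
    also have "\<dots> = ((c t)\<^sup>2 + (d t)\<^sup>2 * N\<^sup>2) * (D t)\<^sup>2"
      by (simp add: algebra_simps)
    finally have "2 * d t * (D t)\<^sup>2 = ((c t)\<^sup>2 + (d t)\<^sup>2 * N\<^sup>2) * (D t)\<^sup>2" .
    with D[of t] show ?thesis by simp
  qed
  then have "sp_curve (c t) (d t) v \<in> SpU1" for t
    unfolding N_def by (rule sp_curve_SpU1)
  moreover have deriv: "((\<lambda>t. sp_curve (c t) (d t) v) has_vector_derivative
      c1 t *\<^sub>R sp_gen v + d1 t *\<^sub>R (sp_gen v ** sp_gen v)) (at t)" for t
  proof -
    have "((\<lambda>t. f t *\<^sub>R M) has_vector_derivative f' *\<^sub>R M) (at t)"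
      if "(f has_real_derivative f') (at t)" for f f' and M :: "'a matT"
      using bounded_linear.has_vector_derivative[OF bounded_linear_scaleR_left] that
      by (simp add: has_real_derivative_iff_has_vector_derivative)
    from has_vector_derivative_add[OF has_vector_derivative_add[OF has_vector_derivative_const this[OF c']] this[OF d']]
    show ?thesis by (simp add: sp_curve_def)
  qed
  moreover have "sp_curve (c 0) (d 0) v = mat 1"
    by (simp add: sp_curve_def c_def d_def)
  moreover have "c1 0 *\<^sub>R sp_gen v + d1 0 *\<^sub>R (sp_gen v ** sp_gen v) = sp_gen v"
    by (simp add: c1_def d1_def D_def)
  ultimately show ?thesis
    using deriv[of 0] unfolding lie_algebra_def mem_Collect_eq
    by (intro exI[of _ "\<lambda>t. sp_curve (c t) (d t) v"])
      (auto intro: differentiableI_vector)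
qed

section \<open>The generator of u(1)\<close>

definition u_gen :: "'n::finite matT" where
  "u_gen = block_diag (mat \<i>) (2 * \<i>)"

text \<open>The curve takes \<open>a = mat 1\<close> and lets \<open>b\<close> run through the unit
  circle. The square of \<open>b\<close> in the last entry doubles the speed there.\<close>

lemma u_gen_lie_algebra: "u_gen \<in> lie_algebra (SpU1 :: 'n::finite matT set)"
proof -
  let ?\<gamma> = "\<lambda>t. \<rho> (mat 1 :: 'n matE) (cis t)"
  have "linear (\<lambda>c. block_diag (mat c :: 'n matE) 0)" "linear (\<lambda>c. block_diag (mat 0 :: 'n matE) c)"
    by (auto simp: linear_iff mat_def intro!: idxT_matrix_eqI)
  then have lin: "bounded_linear (\<lambda>c. block_diag (mat c :: 'n matE) 0)" "bounded_linear (\<lambda>c. block_diag (mat 0 :: 'n matE) c)"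
    by (simp_all add: linear_conv_bounded_linear)
  have \<gamma>: "?\<gamma> t = block_diag (mat (cis t)) 0 + block_diag (mat 0) (cis (2 * t))" for t
    by (intro idxT_matrix_eqI) (simp_all add: \<rho>_def Complex.DeMoivre)
  have cis: "((\<lambda>t. cis (k * t)) has_vector_derivative k *\<^sub>R (\<i> * cis (k * t))) (at t)" for k t
    by (auto intro!: derivative_eq_intros simp: has_vector_derivative_def)
  have deriv: "(?\<gamma> has_vector_derivative block_diag (mat (\<i> * cis t)) 0 + block_diag (mat 0) (2 *\<^sub>R (\<i> * cis (2 * t)))) (at t)" for t
    unfolding \<gamma>
    using cis[of 1 t] cis[of 2 t] by (intro has_vector_derivative_add bounded_linear.has_vector_derivative[OF lin(1)]
        bounded_linear.has_vector_derivative[OF lin(2)]) simp_all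
  have "?\<gamma> t \<in> SpU1" for t
proof -
    have "cis t \<in> U1" by (simp add: U1_def)
    then show ?thesis unfolding SpU1_def using one_Sp by blast
  qed
  moreover have "?\<gamma> 0 = mat 1"
    by (simp add: \<rho>_def block_diag_one)
  moreover have "block_diag (mat (\<i> * cis 0)) 0 + block_diag (mat 0) (2 *\<^sub>R (\<i> * cis (2 * 0))) = (u_gen :: 'n matT)"
    by (intro idxT_matrix_eqI) (simp_all add: u_gen_def mat_def scaleR_conv_of_real)
  ultimately show ?thesis
    using deriv[of 0] unfolding lie_algebra_def mem_Collect_eq
    by (intro exI[of _ ?\<gamma>]) (auto intro: differentiableI_vector deriv)
qed

lemma two_form_u_gen: "two_form u_gen X Y = - u_form X Y"
proof -
  have "u_gen *v X = (\<i> *s X) + axis None (\<i> * X $ None)"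
    by (simp add: vec_eq_iff split_option_all u_gen_def block_diag_mult_vec mat_def axis_def if_distrib if_distribR cong: if_cong)
  then show ?thesis
    by (simp add: two_form_herm u_form_def) (simp add: herm_def axis_def)
qed

section \<open>The symmetric square\<close>

interpretation fscale: vector_space "fscale :: real \<Rightarrow> ('v \<Rightarrow> 'v \<Rightarrow> 'v \<Rightarrow> 'v \<Rightarrow> real) \<Rightarrow> _"
  by (rule vector_space_fscale)

lemma subspace_S2: "fscale.subspace (S2 H)"
  by (simp add: S2_def)

lemma S2_add: "R \<in> S2 H \<Longrightarrow> S \<in> S2 H \<Longrightarrow> (\<lambda>X Y Z W. R X Y Z W + S X Y Z W) \<in> S2 H"
  using fscale.subspace_add[OF subspace_S2] by (simp add: plus_fun_def)

lemma S2_scale: "R \<in> S2 H \<Longrightarrow> (\<lambda>X Y Z W. c * R X Y Z W) \<in> S2 H"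
  using fscale.subspace_scale[OF subspace_S2] by (simp add: fscale_def)

lemma S2_diff: "R \<in> S2 H \<Longrightarrow> S \<in> S2 H \<Longrightarrow> (\<lambda>X Y Z W. R X Y Z W - S X Y Z W) \<in> S2 H"
  using fscale.subspace_diff[OF subspace_S2] by (simp add: fun_diff_def)

lemma S2_sum:
  assumes "\<And>i. R i \<in> S2 H"
  shows "(\<lambda>X Y Z W. \<Sum>i\<in>A. R i X Y Z W) \<in> S2 H"
proof (induction A rule: infinite_finite_induct)
  case (insert i A)
  then show ?case using S2_add[OF assms] by simp
qed (use fscale.subspace_0[OF subspace_S2] in \<open>simp_all add: zero_fun_def\<close>)

text \<open>Closure under differences accommodates polarisation. As \<open>sym_prod\<close> is
  additive in each factor, products of such forms stay in \<open>S2 H\<close>.\<close>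

inductive_set lin_hull :: "('v \<Rightarrow> 'v \<Rightarrow> real) set \<Rightarrow> ('v \<Rightarrow> 'v \<Rightarrow> real) set" for H where
  base: "\<alpha> \<in> H \<Longrightarrow> \<alpha> \<in> lin_hull H"
| diff: "\<alpha> \<in> lin_hull H \<Longrightarrow> \<beta> \<in> lin_hull H \<Longrightarrow> (\<lambda>X Y. \<alpha> X Y - \<beta> X Y) \<in> lin_hull H"

lemma sym_prod_lin_hull:
  assumes "\<alpha> \<in> lin_hull H" "\<beta> \<in> lin_hull H"
  shows "sym_prod \<alpha> \<beta> \<in> S2 H"
proof -
  have *: "sym_prod \<alpha> \<beta> \<in> S2 H" if "\<alpha> \<in> H" for \<alpha>
    using assms(2)
  proof induction
    case (base \<beta>)
    with that show ?case unfolding S2_def by (auto intro: fscale.span_base)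
  next
    case (diff \<beta> \<gamma>)
    from S2_diff[OF this(3,4)] show ?case
      by (rule back_subst[of "\<lambda>R. R \<in> S2 H"]) (simp add: fun_eq_iff sym_prod_def algebra_simps)
  qed
  show ?thesis
    using assms(1)
  proof induction
    case (base \<alpha>)
    with * show ?case by blast
  next
    case (diff \<beta> \<gamma>)
    from S2_diff[OF this(3,4)] show ?case
      by (rule back_subst[of "\<lambda>R. R \<in> S2 H"]) (simp add: fun_eq_iff sym_prod_def algebra_simps)
  qed
qed

section \<open>Symmetric products of forms of the Lie algebra\<close>

abbreviation spu1_forms :: "('n::finite T \<Rightarrow> 'n T \<Rightarrow> real) set" where
  "spu1_forms \<equiv> two_form ` lie_algebra SpU1"

text \<open>Polarisation: \<open>sp_form\<close> is symmetric and bilinear in its first two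
  arguments, and half its real part on the diagonal is the form of \<open>sp_gen\<close>.\<close>

lemma Re_sp_form: "(\<lambda>X Y. Re (sp_form u v X Y)) \<in> lin_hull spu1_forms"
proof -
  have "two_form (sp_gen u) \<in> lin_hull spu1_forms" for u :: "'a T"
    using sp_gen_lie_algebra by (blast intro: lin_hull.base)
  then have "(\<lambda>X Y. two_form (sp_gen (u + v)) X Y - two_form (sp_gen u) X Y - two_form (sp_gen v) X Y) \<in> lin_hull spu1_forms"
    by (intro lin_hull.diff)
  then show ?thesis
    by (rule back_subst[of "\<lambda>R. R \<in> lin_hull _"]) (simp add: fun_eq_iff two_form_sp_gen sp_form_def field_simps)
qed

lemma sp_form_scale: "sp_form (c *s u) v X Y = c * sp_form u v X Y"
  by (simp add: sp_form_def algebra_simps)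

text \<open>The imaginary part of z is the real part of -i z, and the factor -i can be absorbed into
  \<open>u\<close>.\<close>

lemma Im_sp_form: "(\<lambda>X Y. Im (sp_form u v X Y)) \<in> lin_hull spu1_forms"
  using Re_sp_form[of "(-\<i>) *s u" v] unfolding sp_form_scale by simp

text \<open>The real part of a product is the product of real parts minus that of imaginary parts;
  the coefficient \<open>c\<close> is absorbed into \<open>u\<close>.\<close>

lemma Re_sp_form_product:
  "(\<lambda>X Y Z W. Re (c * (sp_form u v X Y * sp_form u' v' Z W + sp_form u' v' X Y * sp_form u v Z W))) \<in> S2 spu1_forms"
proof -
  let ?re = "\<lambda>u v X Y. Re (sp_form u v X Y)" and ?im = "\<lambda>u v X Y. Im (sp_form u v X Y)"
  from S2_diff[OF sym_prod_lin_hull[OF Re_sp_form Re_sp_form] sym_prod_lin_hull[OF Im_sp_form Im_sp_form]]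
  have "(\<lambda>X Y Z W. sym_prod (?re (c *s u) v) (?re u' v') X Y Z W - sym_prod (?im (c *s u) v) (?im u' v') X Y Z W) \<in> S2 spu1_forms" .
  then show ?thesis
    by (rule back_subst[of "\<lambda>R. R \<in> S2 _"]) (simp add: fun_eq_iff sym_prod_def sp_form_scale algebra_simps)
qed

lemma sp_form_bvec: "sp_form (bvec i) (bvec j) X Y = chi i j X Y + chi j i X Y"
  by (simp add: sp_form_def chi_def herm_bvec scoord_def)

lemma sum4_perm:
  "sum4 (\<lambda>i j k l. f j i k l) = sum4 f" "sum4 (\<lambda>i j k l. f i j l k) = sum4 f" "sum4 (\<lambda>i j k l. f i k j l) = sum4 f"
  unfolding sum4_def
    apply (rule sum.swap)
   apply (rule sum.cong[OF refl], rule sum.cong[OF refl], rule sum.swap)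
  apply (rule sum.cong[OF refl], rule sum.swap)
  done

lemma sum4_add: "sum4 (\<lambda>i j k l. f i j k l + g i j k l) = sum4 f + sum4 g"
  by (simp add: sum4_def sum.distrib)

text \<open>Averaging over the eight index permutations generated by exchanging within a pair and
  exchanging the pairs turns each \<open>chi\<close> into \<open>sp_form\<close> and the product
  into a symmetric product.\<close>

lemma hk_tensor_sp_form:
  assumes "t \<in> S4"
  shows "hk_tensor t X Y Z W = sum4 (\<lambda>i j k l. t i j k l / 8 *
    (sp_form (bvec i) (bvec j) X Y * sp_form (bvec k) (bvec l) Z W + sp_form (bvec k) (bvec l) X Y * sp_form (bvec i) (bvec j) Z W))"
proof -
  have t: "t j i k l = t i j k l" "t i j l k = t i j k l" "t i k j l = t i j k l" for i j k l
    using assms unfolding S4_def by blast+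
  define f where "f = (\<lambda>i j k l. t i j k l * (chi i j X Y * chi k l Z W))"
  define g where "g = (\<lambda>i j k l. t i j k l * (chi k l X Y * chi i j Z W))"
  have f: "sum4 f = hk_tensor t X Y Z W"
    by (simp add: f_def sum4_def hk_tensor_def)
  have "sum4 (\<lambda>i j k l. f j i k l) = sum4 f" "sum4 (\<lambda>i j k l. f i j l k) = sum4 f"
    "sum4 (\<lambda>i j k l. f j i l k) = sum4 f"
    using sum4_perm(1)[of f] sum4_perm(2)[of f] sum4_perm(1)[of "\<lambda>i j k l. f i j l k"] by simp_all
  moreover have "sum4 (\<lambda>i j k l. g j i k l) = sum4 g" "sum4 (\<lambda>i j k l. g i j l k) = sum4 g"
    "sum4 (\<lambda>i j k l. g j i l k) = sum4 g"
    using sum4_perm(1)[of g] sum4_perm(2)[of g] sum4_perm(1)[of "\<lambda>i j k l. g i j l k"] by simp_all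
  moreover have "sum4 g = sum4 f"
  proof -
    \<comment> \<open>Exchanging the two pairs of indices is a product of four adjacent
      transpositions.\<close>
    have "sum4 (\<lambda>i j k l. f k l i j) = sum4 f"
      using sum4_perm(3)[of "\<lambda>i j k l. f j l i k"] sum4_perm(1)[of "\<lambda>i j k l. f i l j k"]
        sum4_perm(2)[of "\<lambda>i j k l. f i k j l"] sum4_perm(3)[of f] by simp
    moreover have "f k l i j = g i j k l" for i j k l
      using t(3)[of k i l j] t(1)[of i k l j] t(2)[of i k j l] t(3)[of i j k l] by (simp add: f_def g_def)
    ultimately show ?thesis by simp
  qed
  moreover have "t i j k l / 8 * (sp_form (bvec i) (bvec j) X Y * sp_form (bvec k) (bvec l) Z W
      + sp_form (bvec k) (bvec l) X Y * sp_form (bvec i) (bvec j) Z W)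
    = (f i j k l + f j i k l + f i j l k + f j i l k + g i j k l + g j i k l + g i j l k + g j i l k) / 8" for i j k l
  proof -
    obtain c where "c = t i j k l" by blast
    then have "t i j k l = c" "t j i k l = c" "t i j l k = c" "t j i l k = c"
      using t(1)[of i j k l] t(2)[of i j k l] t(1)[of i j l k] by auto
    then show ?thesis by (simp add: f_def g_def sp_form_bvec algebra_simps)
  qed
  moreover have "sum4 (\<lambda>i j k l. h i j k l / 8) = sum4 h / 8" for h :: "'a idxE ctensor4"
    by (simp add: sum4_def sum_divide_distrib)
  ultimately show ?thesis unfolding f[symmetric] by (simp only: sum4_add) simp
qed

lemma Re_hk_tensor_S2:
  assumes "t \<in> S4"
  shows "(\<lambda>X Y Z W. Re (hk_tensor t X Y Z W)) \<in> S2 spu1_forms"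
  unfolding hk_tensor_sp_form[OF assms] sum4_def Re_sum
  by (intro S2_sum Re_sp_form_product)

text \<open>Expanding \<open>sp_form\<close> into \<open>chi\<close> leaves two kinds of
  contraction: indices in equal order give products of \<open>herm\<close>, indices in crossed order
  give products of \<open>sympl\<close>.\<close>

lemma casimir_sp_form:
  "casimir X Y Z W = (\<Sum>i\<in>UNIV. \<Sum>j\<in>UNIV. Re (sp_form (bvec i) (bvec j) X Y * cnj (sp_form (bvec i) (bvec j) Z W))) / 4"
proof -
  have prod2: "(\<Sum>i\<in>UNIV. \<Sum>j\<in>UNIV. f i * g j) = sum f UNIV * sum g UNIV" for f g :: "'a idxE \<Rightarrow> complex"
    by (simp add: sum_product)
  let ?r = "\<lambda>X i. cnj (X $ Some i)"
  have h: "(\<Sum>i\<in>UNIV. scoord X i * cnj (scoord Y i)) = herm X Y" "(\<Sum>i\<in>UNIV. cnj (X $ Some i) * Y $ Some i) = herm Y X"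
    "(\<Sum>i\<in>UNIV. scoord X i * Y $ Some i) = sympl Y X" "(\<Sum>i\<in>UNIV. cnj (X $ Some i) * cnj (scoord Y i)) = cnj (sympl X Y)" for X Y :: "'a T"
    by (simp_all add: sum_scoord_cnj_scoord herm_def sympl_scoord mult.commute)
  have a: "(\<Sum>i\<in>UNIV. \<Sum>j\<in>UNIV. chi i j X Y * cnj (chi i j Z W)) =
      herm X Z * herm W Y - herm X W * herm Z Y - herm Y Z * herm W X + herm Y W * herm Z X"
  proof -
    have "chi i j X Y * cnj (chi i j Z W) = (scoord X i * cnj (scoord Z i)) * (?r Y j * W $ Some j)
      - (scoord X i * cnj (scoord W i)) * (?r Y j * Z $ Some j)
      - (scoord Y i * cnj (scoord Z i)) * (?r X j * W $ Some j)
      + (scoord Y i * cnj (scoord W i)) * (?r X j * Z $ Some j)" for i j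
      by (simp add: chi_def algebra_simps)
    then show ?thesis by (simp add: sum.distrib sum_subtractf prod2 h)
  qed
  have b: "(\<Sum>i\<in>UNIV. \<Sum>j\<in>UNIV. chi i j X Y * cnj (chi j i Z W)) =
      sympl W X * cnj (sympl Y Z) - sympl Z X * cnj (sympl Y W) - sympl W Y * cnj (sympl X Z) + sympl Z Y * cnj (sympl X W)"
  proof -
    have "chi i j X Y * cnj (chi j i Z W) = (scoord X i * W $ Some i) * (?r Y j * cnj (scoord Z j))
      - (scoord X i * Z $ Some i) * (?r Y j * cnj (scoord W j))
      - (scoord Y i * W $ Some i) * (?r X j * cnj (scoord Z j))
      + (scoord Y i * Z $ Some i) * (?r X j * cnj (scoord W j))" for i j
      by (simp add: chi_def algebra_simps)
    then show ?thesis by (simp add: sum.distrib sum_subtractf prod2 h)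
  qed
  have "(\<Sum>i\<in>UNIV. \<Sum>j\<in>UNIV. sp_form (bvec i) (bvec j) X Y * cnj (sp_form (bvec i) (bvec j) Z W)) =
    (\<Sum>i\<in>UNIV. \<Sum>j\<in>UNIV. chi i j X Y * cnj (chi i j Z W)) + (\<Sum>i\<in>UNIV. \<Sum>j\<in>UNIV. chi j i X Y * cnj (chi j i Z W))
    + (\<Sum>i\<in>UNIV. \<Sum>j\<in>UNIV. chi i j X Y * cnj (chi j i Z W)) + (\<Sum>i\<in>UNIV. \<Sum>j\<in>UNIV. chi j i X Y * cnj (chi i j Z W))"
    unfolding sp_form_bvec by (simp add: sum.distrib algebra_simps)
  also have "(\<Sum>i\<in>UNIV. \<Sum>j\<in>UNIV. chi j i X Y * cnj (chi j i Z W)) = (\<Sum>i\<in>UNIV. \<Sum>j\<in>UNIV. chi i j X Y * cnj (chi i j Z W))"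
    by (rule sum.swap)
  also have "(\<Sum>i\<in>UNIV. \<Sum>j\<in>UNIV. chi j i X Y * cnj (chi i j Z W)) = (\<Sum>i\<in>UNIV. \<Sum>j\<in>UNIV. chi i j X Y * cnj (chi j i Z W))"
    by (rule sum.swap)
  finally have "(\<Sum>i\<in>UNIV. \<Sum>j\<in>UNIV. sp_form (bvec i) (bvec j) X Y * cnj (sp_form (bvec i) (bvec j) Z W)) =
    2 * (herm X Z * herm W Y - herm X W * herm Z Y - herm Y Z * herm W X + herm Y W * herm Z X)
    + 2 * (sympl W X * cnj (sympl Y Z) - sympl Z X * cnj (sympl Y W) - sympl W Y * cnj (sympl X Z) + sympl Z Y * cnj (sympl X W))"
    unfolding a b by simp
  from arg_cong[OF this, of Re] show ?thesis
    using herm_commute[of X Z] herm_commute[of W Y] herm_commute[of X W] herm_commute[of Z Y]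
      sympl_commute[of W X] sympl_commute[of Y Z] sympl_commute[of Z X] sympl_commute[of Y W]
    by (simp add: casimir_def Re_sum)
qed

lemma casimir_S2: "casimir \<in> S2 spu1_forms"
proof -
  let ?re = "\<lambda>i j X Y. Re (sp_form (bvec i) (bvec j) X Y)" and ?im = "\<lambda>i j X Y. Im (sp_form (bvec i) (bvec j) X Y)"
  \<comment> \<open>The real part of z times the conjugate of w is Re z Re w + Im z Im w. The factor
    1/8 is 1/4 halved, as \<open>sym_prod\<close> of a form with itself is twice the square.\<close>
  have "(\<lambda>X Y Z W. 1/8 * (\<Sum>i\<in>UNIV. \<Sum>j\<in>UNIV. sym_prod (?re i j) (?re i j) X Y Z W + sym_prod (?im i j) (?im i j) X Y Z W)) \<in> S2 spu1_forms"
    by (intro S2_scale S2_sum S2_add sym_prod_lin_hull Re_sp_form Im_sp_form)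
  then show ?thesis
    by (rule back_subst[of "\<lambda>R. R \<in> S2 _"])
      (simp add: fun_eq_iff sym_prod_def casimir_sp_form sum_distrib_left sum_divide_distrib add_divide_distrib)
qed

lemma torsion_curv_S2: "torsion_curv \<in> S2 spu1_forms"
proof -
  have u: "two_form u_gen \<in> lin_hull spu1_forms"
    using u_gen_lie_algebra by (blast intro: lin_hull.base)
  have "(\<lambda>X Y Z W. (- 1 / 2) * sym_prod (two_form u_gen) (two_form u_gen) X Y Z W - 1 / 2 * casimir X Y Z W) \<in> S2 spu1_forms"
    by (intro S2_diff S2_scale sym_prod_lin_hull u casimir_S2)
  then show ?thesis
    by (rule back_subst[of "\<lambda>R. R \<in> S2 _"]) (simp add: fun_eq_iff sym_prod_def torsion_curv_def two_form_u_gen)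
qed

section \<open>Tensors with vanishing Bianchi sum\<close>

lemma spu1_two_form:
  assumes "A \<in> spu1"
  shows "two_form A X Y = Re (herm (A *v X) Y + A $ None $ None * X $ None * cnj (Y $ None))"
proof -
  have "(A *v X) $ None = A $ None $ None * X $ None"
    using assms by (simp add: spu1_def matrix_vector_mult_def sum_idxT del: split_paired_All)
  then show ?thesis by (simp add: two_form_herm)
qed

lemma spu1_skew:
  assumes "A \<in> spu1"
  shows "herm X (A *v Y) = - herm (A *v X) Y"
    "sympl X (A *v Y) = A $ None $ None * sympl X Y - sympl (A *v X) Y" "Re (A $ None $ None) = 0"
proof -
  have "herm (A *v X) Y + herm X (A *v Y) = 0" "sympl (A *v X) Y + sympl X (A *v Y) = A $ None $ None * sympl X Y"
    using assms unfolding spu1_def by blast+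
  then show "herm X (A *v Y) = - herm (A *v X) Y"
    "sympl X (A *v Y) = A $ None $ None * sympl X Y - sympl (A *v X) Y"
    by (simp_all add: algebra_simps eq_neg_iff_add_eq_0)
qed (use assms in \<open>simp add: spu1_def\<close>)

lemma spu1_linear:
  assumes "A \<in> spu1" "B \<in> spu1"
  shows "r *\<^sub>R A + s *\<^sub>R B \<in> spu1"
  using assms unfolding spu1_def
  by (simp add: matrix_vector_mult_add_rdistrib scaleR_matrix_vector algebra_simps eq_neg_iff_add_eq_0)
     (simp flip: distrib_left add: scaleR_conv_of_real algebra_simps)

text \<open>Two properties of elements of the symmetric square that survive linear combinations, and
  through which the converse direction handles the span.\<close>

definition form_valued :: "'n::finite tensor4 set" where
  "form_valued = {S. (\<forall>Z W. \<exists>A\<in>spu1. \<forall>X Y. S X Y Z W = two_form A X Y) \<and> (\<forall>X Y Z W. S X Y Z W = S Z W X Y)}"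

lemma two_form_linear: "two_form (r *\<^sub>R A + s *\<^sub>R B) X Y = r * two_form A X Y + s * two_form B X Y"
  by (simp add: two_form_def matrix_vector_mult_add_rdistrib scaleR_matrix_vector inner_add_left)

lemma S2_form_valued: "S2 spu1_forms \<subseteq> (form_valued :: 'n::finite tensor4 set)"
  unfolding S2_def
proof (rule fscale.span_minimal)
  show "fscale.subspace (form_valued :: 'n tensor4 set)"
  proof (rule fscale.subspaceI)
    have "two_form (0 :: 'n matT) X Y = 0" for X Y
      by (simp add: two_form_def)
    moreover have "(0 :: 'n matT) \<in> spu1" by (simp add: spu1_def)
    ultimately show "(0 :: 'n tensor4) \<in> form_valued"
      by (auto simp: form_valued_def)
    show "R + S \<in> form_valued" if R: "R \<in> form_valued" and S: "S \<in> form_valued" for R S :: "'n tensor4"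
      unfolding form_valued_def
    proof (intro CollectI conjI allI)
      fix Z W
      obtain A where "A \<in> spu1" "\<forall>X Y. R X Y Z W = two_form A X Y"
        using R unfolding form_valued_def by blast
      moreover obtain B where "B \<in> spu1" "\<forall>X Y. S X Y Z W = two_form B X Y"
        using S unfolding form_valued_def by blast
      ultimately show "\<exists>A\<in>spu1. \<forall>X Y. (R + S) X Y Z W = two_form A X Y"
        by (intro bexI[OF _ spu1_linear[of A B 1 1]]) (simp_all add: two_form_linear[of 1 A 1 B, simplified])
    next
      show "(R + S) X Y Z W = (R + S) Z W X Y" for X Y Z W
        using that unfolding form_valued_def by simp
    qed
    show "fscale c R \<in> form_valued" if R: "R \<in> form_valued" for c and R :: "'n tensor4"
      unfolding form_valued_def
    proof (intro CollectI conjI allI)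
      fix Z W
      obtain A where "A \<in> spu1" "\<forall>X Y. R X Y Z W = two_form A X Y"
        using R unfolding form_valued_def by blast
      then show "\<exists>A\<in>spu1. \<forall>X Y. fscale c R X Y Z W = two_form A X Y"
        by (intro bexI[OF _ spu1_linear[of A A c 0]]) (simp_all add: fscale_def two_form_linear[of c A 0 A, simplified])
    next
      show "fscale c R X Y Z W = fscale c R Z W X Y" for X Y Z W
        using that unfolding form_valued_def fscale_def by simp
    qed
  qed
  show "{sym_prod \<alpha> \<beta> | \<alpha> \<beta>. \<alpha> \<in> spu1_forms \<and> \<beta> \<in> spu1_forms} \<subseteq> (form_valued :: 'n tensor4 set)"
  proof clarify
    fix A B :: "'n matT"
    assume "A \<in> lie_algebra SpU1" "B \<in> lie_algebra SpU1"
    then have "A \<in> spu1" "B \<in> spu1" using lie_algebra_SpU1_subset by blast+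
    then have "\<exists>C\<in>spu1. \<forall>X Y. sym_prod (two_form A) (two_form B) X Y Z W = two_form C X Y" for Z W
      by (intro bexI[OF _ spu1_linear[of A B "two_form B Z W" "two_form A Z W"]])
        (simp_all add: two_form_linear sym_prod_def algebra_simps)
    then show "sym_prod (two_form A) (two_form B) \<in> form_valued"
      by (simp add: form_valued_def sym_prod_def mult.commute)
  qed
qed

lemma herm_nth: "herm X (bvec i) = sympl X (dvec i)"
  by (simp add: herm_bvec sympl_dvec)

lemma dvec_eq: "dvec (k, False) = bvec (k, True)" "dvec (k, True) = - bvec (k, False)"
  by (simp_all add: dvec_def)

text \<open>The scalar by which \<open>B\<close> acts on the last line is also the scalar by which
  it rescales \<open>sympl\<close>, so it is determined by the action on \<open>E\<close>.\<close>

lemma spu1_0: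
  fixes B :: "'n::finite matT"
  assumes "B \<in> spu1" "\<And>Z W. Z $ None = 0 \<Longrightarrow> W $ None = 0 \<Longrightarrow> two_form B Z W = 0"
  shows "two_form B Z W = 0"
proof -
  have h: "herm (B *v bvec i) (bvec j) = 0" for i j
  proof -
    have "two_form B (bvec i) (bvec j) = 0" "two_form B (bvec i) (\<i> *s bvec j) = 0"
      by (intro assms(2); simp)+
    then show ?thesis
      by (simp add: spu1_two_form[OF assms(1)] complex_eq_iff)
  qed
  then have h': "(B *v bvec i) $ Some j = 0" for i j
    by (simp add: herm_bvec)
  have "herm (B *v Z) W = 0" for Z W
  proof -
    have "(B *v Z) $ Some p = 0" for p
      using spu1_skew(1)[OF assms(1), of Z "bvec p"] by (simp add: herm_bvec) (simp add: herm_def h')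
    then show ?thesis by (simp add: herm_def)
  qed
  moreover have "B $ None $ None = 0"
  proof -
    \<comment> \<open>Such an index exists since n is at least 1. On this pair of basis vectors
      \<open>sympl\<close> is 1, so the rescaling relation reduces to the vanishing of the
      scalar.\<close>
    fix k :: 'n
    have "sympl (bvec (k, False)) (B *v bvec (k, True)) = B $ None $ None * sympl (bvec (k, False)) (bvec (k, True)) - sympl (B *v bvec (k, False)) (bvec (k, True))"
      by (rule spu1_skew(2)[OF assms(1)])
    moreover have "sympl (bvec (k, False)) (bvec (k, True)) = 1"
      using sympl_dvec[of "bvec (k, False)" "(k, False)"] by (simp add: dvec_eq)
    moreover have "sympl (bvec i) (B *v bvec j) = 0" "sympl (B *v bvec j) (bvec i) = 0" for i j
      by (simp_all add: sympl_scoord[of "B *v _"] sympl_commute[of "bvec i"] h')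
    ultimately show ?thesis by simp
  qed
  ultimately show ?thesis by (simp add: spu1_two_form[OF assms(1)])
qed

lemma form_valued_sp:
  assumes S: "S \<in> form_valued" and bianchi: "\<And>X Y Z W. bianchi S X Y Z W = 0"
  obtains A where "A \<in> spu1" "A $ None $ None = 0" "\<And>X Y. S X Y Z W = Re (herm (A *v X) Y)"
proof -
  have ex: "\<exists>A\<in>spu1. \<forall>X Y. S X Y Z W = two_form A X Y" and sw: "S X Y Z W = S Z W X Y" for X Y Z W
    using S unfolding form_valued_def by blast+
  define x y :: "'a T" where "x = axis None 1" and "y = axis None \<i>"
  have xy: "x $ Some p = 0" "x $ None = 1" "y $ Some p = 0" "y $ None = \<i>" for p
    by (simp_all add: x_def y_def axis_def)
  have hx: "herm V x = 0" "herm x V = 0" for V by (simp_all add: herm_def xy)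
  obtain B where B: "B \<in> spu1" "\<And>X Y. S X Y x y = two_form B X Y"
    using ex[of x y] by blast
  have E: "two_form B Z W = 0" if "Z $ None = 0" "W $ None = 0" for Z W
  proof -
    obtain A A' where A: "A \<in> spu1" "\<And>X Y. S X Y Z y = two_form A X Y" and A': "A' \<in> spu1" "\<And>X Y. S X Y W y = two_form A' X Y"
      using ex[of Z y] ex[of W y] by blast
    have "S W x Z y = 0"
      using that A by (simp add: spu1_two_form hx)
    moreover have "S x Z W y = 0"
      using that A' spu1_skew(1)[OF A'(1), of x Z] by (simp add: spu1_two_form hx)
    ultimately show ?thesis
      using bianchi[of Z W x y] B(2) by (simp add: bianchi_def)
  qed
  have *: "S x y Z W = 0" for Z W
    unfolding sw[of x y Z W] B(2) by (rule spu1_0[OF B(1) E])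
  obtain A where A: "A \<in> spu1" "\<And>X Y. S X Y Z W = two_form A X Y"
    using ex[of Z W] by blast
  \<comment> \<open>The value of \<open>S\<close> on \<open>x\<close>, \<open>y\<close> is the
    imaginary part of this entry, and its real part vanishes in \<open>spu1\<close>.\<close>
  have "A $ None $ None = 0"
    using *[of Z W] A spu1_skew(3)[OF A(1)] spu1_skew(1)[OF A(1), of x y]
    by (simp add: spu1_two_form xy hx complex_eq_iff)
  with A that show ?thesis by (simp add: spu1_two_form)
qed

section \<open>Tensors with values in sp(n) come from the fourth symmetric power\<close>

lemma herm_expand:
  "herm X V = (\<Sum>i\<in>UNIV. scoord X i * herm (dvec i) V)" "herm V Y = (\<Sum>j\<in>UNIV. cnj (Y $ Some j) * herm V (bvec j))"
proof -
  show "herm X V = (\<Sum>i\<in>UNIV. scoord X i * herm (dvec i) V)"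
    by (simp add: sum_idxE dvec_eq scoord_eq herm_bvec) (simp add: herm_def sum_idxE add.commute)
  show "herm V Y = (\<Sum>j\<in>UNIV. cnj (Y $ Some j) * herm V (bvec j))"
    by (simp add: herm_bvec) (simp add: herm_def mult.commute)
qed

locale sp_curvature =
  fixes S :: "'n::finite tensor4"
  assumes form_valued: "S \<in> form_valued" and bianchi: "\<And>X Y Z W. bianchi S X Y Z W = 0"
begin

text \<open>Twice the component of type (1,0) in the first argument; it is the complex Hermitian
  expression of which \<open>S\<close> is the real part.\<close>

definition hol :: "'n T \<Rightarrow> 'n T \<Rightarrow> 'n T \<Rightarrow> 'n T \<Rightarrow> complex" where
  "hol X Y Z W = of_real (S X Y Z W) - \<i> * of_real (S (\<i> *s X) Y Z W)"

lemma hol_eq: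
  obtains A where "A \<in> spu1" "A $ None $ None = 0" "\<And>X Y. S X Y Z W = Re (herm (A *v X) Y)"
    "\<And>X Y. hol X Y Z W = herm (A *v X) Y"
proof -
  obtain A where A: "A \<in> spu1" "A $ None $ None = 0" "\<And>X Y. S X Y Z W = Re (herm (A *v X) Y)"
    by (rule form_valued_sp[OF form_valued bianchi, of Z W]) blast
  moreover have "hol X Y Z W = herm (A *v X) Y" for X Y
    by (simp add: hol_def A(3) scale_matrix_vector complex_eq_iff)
  ultimately show ?thesis using that by blast
qed

lemma pair_commute: "S X Y Z W = S Z W X Y"
  using form_valued unfolding form_valued_def by blast

lemma anticommute: "S Y X Z W = - S X Y Z W"
proof -
  obtain A where A: "A \<in> spu1" "\<And>X Y. S X Y Z W = Re (herm (A *v X) Y)"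
    by (rule hol_eq[of Z W]) blast
  show ?thesis
    using arg_cong[OF spu1_skew(1)[OF A(1), of Y X], of Re] by (simp add: A(2) herm_commute[of Y])
qed

lemma imaginary: "S (\<i> *s X) (\<i> *s Y) Z W = S X Y Z W"
proof -
  obtain A where A: "A \<in> spu1" "\<And>X Y. S X Y Z W = Re (herm (A *v X) Y)"
    by (rule hol_eq[of Z W]) blast
  show ?thesis by (simp add: A(2) scale_matrix_vector)
qed

lemma imaginary_swap: "S (\<i> *s X) Y Z W = - S X (\<i> *s Y) Z W"
proof -
  obtain A where A: "A \<in> spu1" "\<And>X Y. S X Y Z W = Re (herm (A *v X) Y)"
    by (rule hol_eq[of Z W]) blast
  show ?thesis by (simp add: A(2) scale_matrix_vector)
qed

text \<open>Pairing with \<open>bvec j\<close> under \<open>herm\<close> is pairing with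
  \<open>dvec j\<close> under \<open>sympl\<close>, and \<open>sympl (A *v X) Y\<close> is symmetric
  in \<open>X\<close>, \<open>Y\<close> for an infinitesimally symplectic \<open>A\<close>.\<close>

lemma hol_commute: "hol (dvec i) (bvec j) Z W = hol (dvec j) (bvec i) Z W"
proof -
  obtain A where A: "A \<in> spu1" "A $ None $ None = 0" "\<And>X Y. hol X Y Z W = herm (A *v X) Y"
    by (rule hol_eq[of Z W]) blast
  show ?thesis
    using spu1_skew(2)[OF A(1), of "dvec i" "dvec j"] A(2)
    by (simp add: A(3) herm_nth sympl_commute[of "dvec i"])
qed

text \<open>By skewness of \<open>A\<close> the real part of \<open>hol X Y Z W\<close> is half its
  antisymmetrisation in \<open>X\<close>, \<open>Y\<close>, and antisymmetrising the coordinates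
  produces \<open>chi\<close>.\<close>

lemma expand:
  "of_real (S X Y Z W) = (\<Sum>i\<in>UNIV. \<Sum>j\<in>UNIV. chi i j X Y * hol (dvec i) (bvec j) Z W) / 2"
proof -
  obtain A where A: "A \<in> spu1" "\<And>X Y. S X Y Z W = Re (herm (A *v X) Y)" "\<And>X Y. hol X Y Z W = herm (A *v X) Y"
    by (rule hol_eq[of Z W]) blast
  note skew = spu1_skew(1)[OF A(1)]
  have e: "herm (A *v X) Y = (\<Sum>i\<in>UNIV. \<Sum>j\<in>UNIV. scoord X i * cnj (Y $ Some j) * hol (dvec i) (bvec j) Z W)" for X Y
  proof -
    have "herm (A *v X) (bvec j) = (\<Sum>i\<in>UNIV. scoord X i * herm (A *v dvec i) (bvec j))" for j
      using skew[of X "bvec j"] herm_expand(1)[of X "A *v bvec j"] by (simp add: skew sum_negf)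
    then show ?thesis
      by (subst herm_expand(2), subst sum.swap) (simp add: A(3) sum_distrib_left mult_ac)
  qed
  have "of_real (S X Y Z W) = (herm (A *v X) Y - herm (A *v Y) X) / 2"
    using skew[of Y X] herm_commute[of Y "A *v X"] by (simp add: A(2) complex_eq_iff)
  also have "\<dots> = (\<Sum>i\<in>UNIV. \<Sum>j\<in>UNIV. chi i j X Y * hol (dvec i) (bvec j) Z W) / 2"
    unfolding e by (simp add: chi_def algebra_simps sum_subtractf)
  finally show ?thesis .
qed

text \<open>The (1,0) projections in the first and third arguments contribute 1/2 each, hence the
  divisor 4. On the dual bases the result is the coefficient of \<open>chi i j\<close> times
  \<open>chi k l\<close>.\<close>

definition potential :: "'n idxE ctensor4" where
  "potential i j k l = (hol (dvec k) (bvec l) (dvec i) (bvec j) - \<i> * hol (dvec k) (bvec l) (\<i> *s dvec i) (bvec j)) / 4"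

lemma hk_tensor_potential: "hk_tensor potential X Y Z W = of_real (S X Y Z W)"
proof -
  have h: "hol (dvec i) (bvec j) Z W = 2 * (\<Sum>k\<in>UNIV. \<Sum>l\<in>UNIV. chi k l Z W * potential i j k l)" for i j
    by (simp add: hol_def[of _ _ Z W] pair_commute[of _ _ Z W] expand[of Z W] potential_def
        sum_distrib_left sum_subtractf[symmetric] sum_divide_distrib algebra_simps diff_divide_distrib)
  show ?thesis
    unfolding expand[of X Y Z W] h hk_tensor_def
    by (simp add: sum_distrib_left sum_divide_distrib mult_ac)
qed

text \<open>Exchanging the last two indices reflects values in sp(n), pair symmetry carries this to
  the first two, and the Bianchi identity exchanges first and third. These generate all
  permutations.\<close>

lemma potential_S4: "potential \<in> S4"
proof -
  have p: "potential i j k l = (of_real (S (dvec i) (bvec j) (dvec k) (bvec l)) - \<i> * of_real (S (\<i> *s dvec i) (bvec j) (dvec k) (bvec l))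
      - \<i> * of_real (S (dvec i) (bvec j) (\<i> *s dvec k) (bvec l)) - of_real (S (\<i> *s dvec i) (bvec j) (\<i> *s dvec k) (bvec l))) / 4" for i j k l
    unfolding potential_def hol_def pair_commute[of "dvec k"] pair_commute[of "\<i> *s dvec k"]
    by (simp add: algebra_simps)
  have b: "S X Y Z W = S Z Y X W - S Z X Y W" for X Y Z W
    using bianchi[of X Y Z W] anticommute[of Z Y X W] by (simp add: bianchi_def)
  have s34: "potential i j k l = potential i j l k" for i j k l
    by (simp add: potential_def hol_commute[of k l])
  have pair: "potential i j k l = potential k l i j" for i j k l
    unfolding p pair_commute[of _ _ "dvec k"] pair_commute[of _ _ "\<i> *s dvec k"] by (simp add: algebra_simps)
  have s12: "potential i j k l = potential j i k l" for i j k l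
    using pair[of i j k l] pair[of j i k l] s34[of k l i j] by simp
  \<comment> \<open>The remaining Bianchi term has both \<open>dvec\<close> arguments in one pair,
    where its (2,0) projection vanishes since the forms have type (1,1).\<close>
  have s13: "potential i j k l = potential k j i l" for i j k l
    unfolding p b[of "dvec i" _ "dvec k"] b[of "\<i> *s dvec i" _ "dvec k"] b[of "dvec i" _ "\<i> *s dvec k"]
      b[of "\<i> *s dvec i" _ "\<i> *s dvec k"] imaginary[of "dvec k" "dvec i"] imaginary_swap[of "dvec k" "dvec i"]
    by (simp add: algebra_simps)
  have "potential i j k l = potential i k j l" for i j k l
    using s12[of i j k l] s13[of j i k l] s12[of k i j l] by simp
  with s12 s34 show ?thesis unfolding S4_def by blast
qed

end

section \<open>The isomorphism\<close>

text \<open>The map is easier to write down from \<open>W\<close> to \<open>V\<close>. Injectivity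
  then transports the action laws from \<open>act1\<close> to \<open>act2\<close>, whereas
  invariance of \<open>V\<close> comes from that of \<open>W\<close>.\<close>

lemma rep_isomorphic_inverse:
  assumes vs1: "vector_space sc1" and vs2: "vector_space sc2" and W: "module.subspace sc2 W"
    and bij: "bij_betw \<Psi> W V"
    and add: "\<And>x y. x \<in> W \<Longrightarrow> y \<in> W \<Longrightarrow> \<Psi> (x + y) = \<Psi> x + \<Psi> y"
    and scale: "\<And>c x. x \<in> W \<Longrightarrow> \<Psi> (sc2 c x) = sc1 c (\<Psi> x)"
    and equivariant: "\<And>h x. h \<in> G \<Longrightarrow> x \<in> W \<Longrightarrow> \<Psi> (act2 h x) = act1 h (\<Psi> x)"
    and act2: "\<And>h x. h \<in> G \<Longrightarrow> x \<in> W \<Longrightarrow> act2 h x \<in> W"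
    and G: "mat 1 \<in> G" "\<And>h k. h \<in> G \<Longrightarrow> k \<in> G \<Longrightarrow> h ** k \<in> G"
    and act1_add: "\<And>h x y. h \<in> G \<Longrightarrow> x \<in> V \<Longrightarrow> y \<in> V \<Longrightarrow> act1 h (x + y) = act1 h x + act1 h y"
    and act1_scale: "\<And>h c x. h \<in> G \<Longrightarrow> x \<in> V \<Longrightarrow> act1 h (sc1 c x) = sc1 c (act1 h x)"
    and act1_one: "\<And>x. x \<in> V \<Longrightarrow> act1 (mat 1) x = x"
    and act1_mult: "\<And>h k x. h \<in> G \<Longrightarrow> k \<in> G \<Longrightarrow> x \<in> V \<Longrightarrow> act1 (h ** k) x = act1 h (act1 k x)"
  shows "rep_isomorphic G sc1 V act1 sc2 W act2"
proof -
  interpret vs1: vector_space sc1 by (rule vs1)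
  interpret vs2: vector_space sc2 by (rule vs2)
  have W0: "0 \<in> W" and Wadd: "\<And>x y. x \<in> W \<Longrightarrow> y \<in> W \<Longrightarrow> x + y \<in> W" and Wscale: "\<And>c x. x \<in> W \<Longrightarrow> sc2 c x \<in> W"
    using W by (auto simp: vs2.subspace_def)
  have inj: "x = y" if "\<Psi> x = \<Psi> y" "x \<in> W" "y \<in> W" for x y
    using bij that by (auto simp: bij_betw_def inj_on_def)
  have V: "V = \<Psi> ` W" using bij by (simp add: bij_betw_def)
  have "\<Psi> 0 = 0" using scale[OF W0, of 0] by simp
  then have subV: "vs1.subspace V"
    unfolding V by (auto simp: vs1.subspace_def W0 Wadd Wscale simp flip: add scale intro: rev_image_eqI)
  have "representation G sc1 V act1"
    unfolding representation_def
    using vs1 subV act1_add act1_scale act1_one act1_mult act2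
    by (auto simp: V simp flip: equivariant)
  moreover have "act2 h (x + y) = act2 h x + act2 h y" if "h \<in> G" "x \<in> W" "y \<in> W" for h x y
    using that by (intro inj) (simp_all add: equivariant add act2 Wadd act1_add V)
  moreover have "act2 h (sc2 c x) = sc2 c (act2 h x)" if "h \<in> G" "x \<in> W" for h c x
    using that by (intro inj) (simp_all add: equivariant scale act2 Wscale act1_scale V)
  moreover have "act2 (mat 1) x = x" if "x \<in> W" for x
    using that G by (intro inj) (simp_all add: equivariant act2 act1_one V)
  moreover have "act2 (h ** k) x = act2 h (act2 k x)" if "h \<in> G" "k \<in> G" "x \<in> W" for h k x
    using that by (intro inj) (simp_all add: equivariant act2 act1_mult V G)
  moreover define \<Phi> where "\<Phi> = inv_into W \<Psi>"
  have \<Phi>: "\<Phi> (\<Psi> x) = x" if "x \<in> W" for x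
    unfolding \<Phi>_def using that bij by (simp add: bij_betw_def)
  have "bij_betw \<Phi> V W"
    unfolding \<Phi>_def by (rule bij_betw_inv_into[OF bij])
  moreover have "\<Phi> (x + y) = \<Phi> x + \<Phi> y" if "x \<in> V" "y \<in> V" for x y
    using that by (auto simp: V \<Phi> Wadd simp flip: add)
  moreover have "\<Phi> (sc1 c x) = sc2 c (\<Phi> x)" if "x \<in> V" for c x
    using that by (auto simp: V \<Phi> Wscale simp flip: scale)
  moreover have "\<Phi> (act1 h x) = act2 h (\<Phi> x)" if "h \<in> G" "x \<in> V" for h x
    using that by (auto simp: V \<Phi> act2 simp flip: equivariant)
  ultimately show ?thesis
    unfolding rep_isomorphic_def representation_def[of _ sc2]
    using vs2 W act2 by (intro conjI exI[of _ \<Phi>]) blast+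
qed

section \<open>The equivariant map onto the complexified space of curvature tensors\<close>

definition curv :: "complex \<times> 'n::finite idxE ctensor4 \<Rightarrow> 'n T \<Rightarrow> 'n T \<Rightarrow> 'n T \<Rightarrow> 'n T \<Rightarrow> complex" where
  "curv x X Y Z W = fst x * of_real (torsion_curv X Y Z W) + hk_tensor (snd x) X Y Z W"

definition curv_pair :: "complex \<times> 'n::finite idxE ctensor4 \<Rightarrow> 'n tensor4 \<times> 'n tensor4" where
  "curv_pair x = (\<lambda>X Y Z W. Re (curv x X Y Z W), \<lambda>X Y Z W. Im (curv x X Y Z W))"

lemma curv_add: "curv (x + y) X Y Z W = curv x X Y Z W + curv y X Y Z W"
  by (simp add: curv_def hk_tensor_def sum.distrib algebra_simps)

lemma curv_scale: "curv (CS4E_scale c x) X Y Z W = c * curv x X Y Z W"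
  by (cases x) (simp add: curv_def hk_tensor_def CS4E_scale_def fscale_def sum_distrib_left algebra_simps)

lemma CS4E_closed: "0 \<in> CS4E" "x \<in> CS4E \<Longrightarrow> y \<in> CS4E \<Longrightarrow> x + y \<in> CS4E" "x \<in> CS4E \<Longrightarrow> CS4E_scale c x \<in> CS4E"
proof -
  show "0 \<in> CS4E" by (simp add: CS4E_def S4_def zero_prod_def)
  show "x + y \<in> CS4E" if "x \<in> CS4E" "y \<in> CS4E"
  proof -
    have "snd x \<in> S4" "snd y \<in> S4" using that by (auto simp: CS4E_def)
    then have "snd x + snd y \<in> S4" unfolding S4_def plus_fun_apply mem_Collect_eq by metis
    then show ?thesis by (simp add: CS4E_def plus_prod_def)
  qed
  show "CS4E_scale c x \<in> CS4E" if "x \<in> CS4E"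
  proof -
    have "snd x \<in> S4" using that by (auto simp: CS4E_def)
    then have "fscale c (snd x) \<in> S4" unfolding S4_def fscale_def mem_Collect_eq by metis
    then show ?thesis by (cases x) (simp add: CS4E_def CS4E_scale_def)
  qed
qed

lemma Re_curv_Ra:
  assumes "x \<in> CS4E"
  shows "(\<lambda>X Y Z W. Re (curv x X Y Z W)) \<in> Ra"
proof -
  have t: "snd x \<in> S4" using assms by (auto simp: CS4E_def)
  have "(\<lambda>X Y Z W. Re (fst x) * torsion_curv X Y Z W + Re (hk_tensor (snd x) X Y Z W)) \<in> S2 spu1_forms"
    by (intro S2_add S2_scale torsion_curv_S2 Re_hk_tensor_S2 t)
  then have "(\<lambda>X Y Z W. Re (curv x X Y Z W)) \<in> S2 spu1_forms"
    by (simp add: curv_def)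
  moreover have "bianchi (\<lambda>X Y Z W. Re (curv x X Y Z W)) = fscale (2 * Re (fst x)) (sigma Theta\<^sub>0)"
  proof (intro ext)
    fix X Y Z W :: "'a T"
    have "bianchi (\<lambda>X Y Z W. Re (curv x X Y Z W)) X Y Z W = Re (fst x) * bianchi torsion_curv X Y Z W
      + Re (hk_tensor (snd x) X Y Z W + hk_tensor (snd x) Y Z X W + hk_tensor (snd x) Z X Y W)"
      by (simp add: bianchi_def curv_def distrib_left)
    then show "bianchi (\<lambda>X Y Z W. Re (curv x X Y Z W)) X Y Z W = fscale (2 * Re (fst x)) (sigma Theta\<^sub>0) X Y Z W"
      by (simp add: bianchi_hk_tensor[OF t] bianchi_torsion_curv fscale_def)
  qed
  ultimately show ?thesis by (auto simp: Ra_def)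
qed

lemma curv_pair_Ra:
  assumes "x \<in> CS4E"
  shows "curv_pair x \<in> complexification Ra"
  using Re_curv_Ra[OF assms] Re_curv_Ra[OF CS4E_closed(3)[OF assms], of "- \<i>"]
  by (simp add: curv_pair_def complexification_def curv_scale)

lemma curv_surj:
  assumes "R \<in> Ra"
  obtains x where "x \<in> CS4E" "\<And>X Y Z W. curv x X Y Z W = of_real (R X Y Z W)"
proof -
  obtain c where c: "bianchi R = fscale c (sigma Theta\<^sub>0)" and R: "R \<in> S2 spu1_forms"
    using assms unfolding Ra_def by blast
  \<comment> \<open>The coefficient is halved because the Bianchi sum of \<open>torsion_curv\<close>
    is twice \<open>sigma\<close>.\<close>
  define S where "S = (\<lambda>X Y Z W. R X Y Z W - c / 2 * torsion_curv X Y Z W)"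
  have "S \<in> S2 spu1_forms"
    unfolding S_def by (intro S2_diff S2_scale R torsion_curv_S2)
  moreover have "bianchi S X Y Z W = 0" for X Y Z W
  proof -
    have "bianchi S X Y Z W = bianchi R X Y Z W - c / 2 * bianchi torsion_curv X Y Z W"
      by (simp add: bianchi_def S_def algebra_simps)
    then show ?thesis by (simp add: c bianchi_torsion_curv fscale_def)
  qed
  ultimately interpret sp_curvature S
    using S2_form_valued by unfold_locales auto
  show ?thesis
  proof (rule that)
    show "(of_real (c / 2), potential) \<in> CS4E"
      using potential_S4 by (simp add: CS4E_def)
    show "curv (of_real (c / 2), potential) X Y Z W = of_real (R X Y Z W)" for X Y Z W
      by (simp add: curv_def hk_tensor_potential) (simp add: S_def)
  qed
qed

lemma chi_linear_part: "chi i j X Y - \<i> * chi i j (\<i> *s X) Y = 2 * (scoord X i * cnj (Y $ Some j))"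
  by (simp add: chi_def algebra_simps)

text \<open>The polarisation used for \<open>potential\<close> keeps the (1,0) part of both
  \<open>chi\<close> factors, doubling each; duality of the bases then isolates one coefficient.
  Hence the tensor determines \<open>t\<close>.\<close>

lemma hk_tensor_dvec:
  "4 * t i j k l = hk_tensor t (dvec i) (bvec j) (dvec k) (bvec l) - \<i> * hk_tensor t (\<i> *s dvec i) (bvec j) (dvec k) (bvec l)
    - \<i> * hk_tensor t (dvec i) (bvec j) (\<i> *s dvec k) (bvec l) - hk_tensor t (\<i> *s dvec i) (bvec j) (\<i> *s dvec k) (bvec l)"
proof -
  have polarize: "hk_tensor t X Y Z W - \<i> * hk_tensor t (\<i> *s X) Y Z W
    - \<i> * hk_tensor t X Y (\<i> *s Z) W - hk_tensor t (\<i> *s X) Y (\<i> *s Z) W =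
    (\<Sum>a\<in>UNIV. \<Sum>b\<in>UNIV. \<Sum>c\<in>UNIV. \<Sum>d\<in>UNIV. t a b c d *
      ((chi a b X Y - \<i> * chi a b (\<i> *s X) Y) * (chi c d Z W - \<i> * chi c d (\<i> *s Z) W)))" for X Y Z W
    unfolding hk_tensor_def sum_distrib_left sum_subtractf[symmetric]
    by (intro sum.cong refl) (simp add: algebra_simps)
  have cnj_bvec: "cnj (bvec i $ Some j) = (if i = j then 1 else 0)" for i j :: "'a idxE"
    by simp
  have nest: "(\<Sum>a\<in>UNIV. \<Sum>b\<in>UNIV. \<Sum>c\<in>UNIV. \<Sum>d\<in>UNIV. t a b c d * (2 * (D i a * D j b) * (2 * (D k c * D l d)))) =
    4 * (\<Sum>a\<in>UNIV. (\<Sum>b\<in>UNIV. (\<Sum>c\<in>UNIV. (\<Sum>d\<in>UNIV. t a b c d * D l d) * D k c) * D j b) * D i a)" for D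
    by (simp add: sum_distrib_left sum_distrib_right mult_ac)
  have delta: "(\<Sum>a\<in>UNIV. f a * (if i = a then 1 else 0)) = f i" for f :: "'a idxE \<Rightarrow> complex" and i
    by (simp add: if_distrib cong: if_cong)
  show ?thesis
    unfolding polarize chi_linear_part scoord_dvec cnj_bvec nest[of "\<lambda>i a. if i = a then 1 else 0"] delta by (rule refl)
qed

lemma curv_inj:
  assumes "\<And>X Y Z W. curv x X Y Z W = curv y X Y Z W"
  shows "x = y"
proof -
  \<comment> \<open>On a real basis of the last line every \<open>hk_tensor\<close> vanishes and
    \<open>torsion_curv\<close> does not, which separates the scalar component.\<close>
  define X Y :: "'a T" where "X = axis None 1" and "Y = axis None \<i>"
  have XY: "X $ Some p = 0" "X $ None = 1" "Y $ Some p = 0" "Y $ None = \<i>" for p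
    by (simp_all add: X_def Y_def axis_def)
  have "torsion_curv X Y X Y = - 4"
    by (simp add: torsion_curv_def u_form_def casimir_def herm_def sympl_def XY)
  moreover have "hk_tensor t X Y X Y = 0" for t
    by (simp add: hk_tensor_def chi_def XY)
  ultimately have c: "fst x = fst y"
    using assms[of X Y X Y] by (simp add: curv_def)
  have "hk_tensor (snd x) X Y Z W = hk_tensor (snd y) X Y Z W" for X Y Z W
    using assms[of X Y Z W] by (simp add: curv_def c)
  then have "4 * snd x i j k l = 4 * snd y i j k l" for i j k l
    unfolding hk_tensor_dvec by simp
  then have "snd x = snd y" by (simp add: fun_eq_iff)
  with c show ?thesis by (simp add: prod_eq_iff)
qed

lemma curv_pair_bij: "bij_betw curv_pair CS4E (complexification (Ra :: 'a::finite tensor4 set))"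
  unfolding bij_betw_def
proof
  show "inj_on curv_pair (CS4E :: (complex \<times> 'a idxE ctensor4) set)"
  proof (rule inj_onI)
    fix x y :: "complex \<times> 'a idxE ctensor4"
    assume "curv_pair x = curv_pair y"
    then have "curv x X Y Z W = curv y X Y Z W" for X Y Z W
      unfolding curv_pair_def prod.inject fun_eq_iff by (simp add: complex_eq_iff)
    then show "x = y" by (rule curv_inj)
  qed
  show "curv_pair ` CS4E = complexification (Ra :: 'a tensor4 set)"
  proof (intro equalityI subsetI)
    fix P :: "'a tensor4 \<times> 'a tensor4"
    assume "P \<in> complexification Ra"
    then obtain R R' where P: "P = (R, R')" "R \<in> Ra" "R' \<in> Ra"
      by (auto simp: complexification_def)
    obtain x where x: "x \<in> CS4E" "\<And>X Y Z W. curv x X Y Z W = of_real (R X Y Z W)"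
      using curv_surj[OF P(2)] by blast
    obtain x' where x': "x' \<in> CS4E" "\<And>X Y Z W. curv x' X Y Z W = of_real (R' X Y Z W)"
      using curv_surj[OF P(3)] by blast
    have "curv_pair (x + CS4E_scale \<i> x') = P"
      by (simp add: curv_pair_def curv_add curv_scale x x' P)
    then show "P \<in> curv_pair ` CS4E"
      using CS4E_closed(2)[OF x(1) CS4E_closed(3)[OF x'(1)]] by blast
  qed (auto simp: curv_pair_Ra)
qed

lemma curv_act:
  assumes "h \<in> SpU1"
  shows "curv (CS4E_act h x) X Y Z W = curv x (matrix_inv h *v X) (matrix_inv h *v Y) (matrix_inv h *v Z) (matrix_inv h *v W)"
proof -
  obtain a b where h: "h = \<rho> a b" "a \<in> Sp" "b \<in> U1"
    using assms unfolding SpU1_def by blast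
  then interpret rho_inverse a b by unfold_locales
  show ?thesis
    using torsion_curv_iota[of X Y Z W] hk_tensor_iota[of "snd x" X Y Z W]
    by (cases x) (simp add: curv_def CS4E_act_def S4E_act_rho h \<iota>_def)
qed

lemma vector_space_cx_scale: "vector_space (cx_scale (fscale :: real \<Rightarrow> 'n::finite tensor4 \<Rightarrow> _))"
  by unfold_locales (auto simp: cx_scale_def fscale_def fun_eq_iff algebra_simps)

lemma vector_space_CS4E_scale: "vector_space CS4E_scale"
  by unfold_locales (auto simp: CS4E_scale_def fscale_def fun_eq_iff algebra_simps)

lemma tensor_act_mult:
  assumes "h \<in> SpU1" "k \<in> SpU1"
  shows "tensor_act (h ** k) R = tensor_act h (tensor_act k R)"
proof -
  have "matrix_inv (h ** k) = matrix_inv k ** matrix_inv h"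
    using assms by (simp add: matrix_inv_unitary SpU1_unitary SpU1_mult cadjoint_mult)
  then show ?thesis
    by (simp add: tensor_act_def fun_eq_iff matrix_vector_mul_assoc)
qed

theorem proposition4p1:
  shows "rep_isomorphic (SpU1 :: 'n::finite matT set)
           (cx_scale fscale) (complexification Ra) (cx_act tensor_act)
           CS4E_scale CS4E CS4E_act"
proof (rule rep_isomorphic_inverse[where \<Psi> = curv_pair])
  show "vector_space (cx_scale (fscale :: real \<Rightarrow> 'n tensor4 \<Rightarrow> _))" "vector_space (CS4E_scale :: complex \<Rightarrow> _ \<times> 'n idxE ctensor4 \<Rightarrow> _)"
    by (rule vector_space_cx_scale vector_space_CS4E_scale)+
  then interpret vector_space "CS4E_scale :: complex \<Rightarrow> _ \<times> 'n idxE ctensor4 \<Rightarrow> _" by blast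
  show "subspace CS4E"
    by (simp add: subspace_def CS4E_closed)
  show "bij_betw curv_pair CS4E (complexification Ra)"
    by (rule curv_pair_bij)
  show "mat 1 \<in> SpU1" by (rule one_SpU1)
  show "h ** k \<in> SpU1" if "h \<in> SpU1" "k \<in> SpU1" for h k :: "'n matT"
    using that by (rule SpU1_mult)
  show "curv_pair (x + y) = curv_pair x + curv_pair y" for x y :: "_ \<times> 'n idxE ctensor4"
    by (simp add: curv_pair_def curv_add fun_eq_iff)
  show "curv_pair (CS4E_scale c x) = cx_scale fscale c (curv_pair x)" for c and x :: "_ \<times> 'n idxE ctensor4"
    by (simp add: curv_pair_def curv_scale cx_scale_def fscale_def fun_eq_iff)
  show "curv_pair (CS4E_act h x) = cx_act tensor_act h (curv_pair x)" if "h \<in> SpU1" for h and x :: "_ \<times> 'n idxE ctensor4"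
    using that by (simp add: curv_pair_def curv_act cx_act_def tensor_act_def fun_eq_iff)
  show "CS4E_act h x \<in> CS4E" if h: "h \<in> SpU1" and x: "x \<in> CS4E" for h and x :: "_ \<times> 'n idxE ctensor4"
  proof -
    obtain a b where "h = \<rho> a b" "a \<in> Sp" "b \<in> U1"
      using h unfolding SpU1_def by blast
    with x show ?thesis
      by (cases x) (auto simp: CS4E_def CS4E_act_def S4E_act_rho act4_S4)
  qed
  show "cx_act tensor_act h (x + y) = cx_act tensor_act h x + cx_act tensor_act h y" for h and x y :: "'n tensor4 \<times> 'n tensor4"
    by (cases x; cases y) (simp add: cx_act_def tensor_act_def fun_eq_iff)
  show "cx_act tensor_act h (cx_scale fscale c x) = cx_scale fscale c (cx_act tensor_act h x)" for h c and x :: "'n tensor4 \<times> 'n tensor4"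
    by (cases x) (simp add: cx_act_def tensor_act_def cx_scale_def fscale_def fun_eq_iff)
  show "cx_act tensor_act (mat 1) x = x" for x :: "'n tensor4 \<times> 'n tensor4"
  proof -
    have "matrix_inv (mat 1 :: 'n matT) = mat 1"
      by (simp add: matrix_inv_unitary SpU1_unitary one_SpU1 cadjoint_mat)
    then show ?thesis
      by (cases x) (simp add: cx_act_def tensor_act_def fun_eq_iff)
  qed
  show "cx_act tensor_act (h ** k) x = cx_act tensor_act h (cx_act tensor_act k x)"
    if "h \<in> SpU1" "k \<in> SpU1" for h k and x :: "'n tensor4 \<times> 'n tensor4"
    using that by (cases x) (simp add: cx_act_def tensor_act_mult)
qed

end
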